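(* Let $G$ be a finitely generated periodic group of $C^1$-diffeomorphisms of the $2$-sphere $\mathbb{S}^2$ with even bounded orders. Then $G$ is finite.
   Context: A group $G$ is periodic if every $g\in G$ has finite order. $G$ has even bounded orders if every non-identity element of $G$ has even order and there is a uniform bound $N$ such that every element of $G$ has order at most $N$. A group of $C^1$-diffeomorphisms of $\mathbb{S}^2$ is a subgroup of the group of all $C^1$-diffeomorphisms of $\mathbb{S}^2$. *)

theory Defs
  imports "HOL-Analysis.Analysis" "HOL-Algebra.Bij" "HOL-Algebra.Generated_Groups"
    "HOL-Algebra.Multiplicative_Group"
begin

text \<open>
  A map defined on a subset of a normed space is \<open>C\<^sup>1\<close> if near every point of the subset it extends
  to a \<open>C\<^sup>1\<close> map on an open subset of the ambient space. For embedded submanifolds such as the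
  sphere this agrees with being \<open>C\<^sup>1\<close> in charts.
\<close>

definition C1_map_on :: "'a::real_normed_vector set \<Rightarrow> ('a \<Rightarrow> 'b::real_normed_vector) \<Rightarrow> bool" where
  "C1_map_on S f \<longleftrightarrow>
     (\<forall>x\<in>S. \<exists>U F (F' :: 'a \<Rightarrow> 'a \<Rightarrow>\<^sub>L 'b). open U \<and> x \<in> U \<and> (\<forall>y\<in>S \<inter> U. F y = f y) \<and>
        (\<forall>y\<in>U. (F has_derivative blinfun_apply (F' y)) (at y)) \<and> continuous_on U F')"

definition C1_diffeos :: "'a::real_normed_vector set \<Rightarrow> ('a \<Rightarrow> 'a) set" where
  "C1_diffeos S = {f \<in> Bij S. C1_map_on S f \<and> C1_map_on S (inv_into S f)}"

text \<open>Elements are functions that take the value \<open>undefined\<close> outside \<open>S\<close>, as in \<^const>\<open>BijGroup\<close>.\<close>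

definition Diff1 :: "'a::real_normed_vector set \<Rightarrow> ('a \<Rightarrow> 'a) monoid" where
  "Diff1 S = (BijGroup S)\<lparr>carrier := C1_diffeos S\<rparr>"

abbreviation S2 :: "(real^3) set" where
  "S2 \<equiv> sphere 0 1"

definition finitely_generated_group :: "('a, 'b) monoid_scheme \<Rightarrow> bool" where
  "finitely_generated_group G \<longleftrightarrow>
     (\<exists>A. finite A \<and> A \<subseteq> carrier G \<and> generate G A = carrier G)"

text \<open>The library's \<open>group.ord\<close> is \<open>0\<close> on elements of infinite order.\<close>

definition periodic_group :: "('a, 'b) monoid_scheme \<Rightarrow> bool" where
  "periodic_group G \<longleftrightarrow> (\<forall>g\<in>carrier G. 0 < group.ord G g)"

definition even_bounded_orders :: "('a, 'b) monoid_scheme \<Rightarrow> bool" where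
  "even_bounded_orders G \<longleftrightarrow>
     (\<forall>g\<in>carrier G. g \<noteq> \<one>\<^bsub>G\<^esub> \<longrightarrow> 0 < group.ord G g \<and> even (group.ord G g)) \<and>
     (\<exists>N. \<forall>g\<in>carrier G. 0 < group.ord G g \<and> group.ord G g \<le> N)"

lemma C1_map_on_cong:
  assumes "\<And>x. x \<in> S \<Longrightarrow> f x = g x"
  shows "C1_map_on S f \<longleftrightarrow> C1_map_on S g"
  using assms by (simp add: C1_map_on_def)

lemma C1_map_on_ident: "C1_map_on S (\<lambda>x. x)"
  unfolding C1_map_on_def
proof
  fix x assume "x \<in> S"
  show "\<exists>U F (F' :: 'a \<Rightarrow> 'a \<Rightarrow>\<^sub>L 'a). open U \<and> x \<in> U \<and> (\<forall>y\<in>S \<inter> U. F y = y) \<and>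
        (\<forall>y\<in>U. (F has_derivative blinfun_apply (F' y)) (at y)) \<and> continuous_on U F'"
    by (rule exI[of _ UNIV], rule exI[of _ "\<lambda>x. x"], rule exI[of _ "\<lambda>_. id_blinfun"])
      (auto simp: id_blinfun.rep_eq)
qed

lemma C1_map_on_compose:
  fixes f :: "'a::real_normed_vector \<Rightarrow> 'b::real_normed_vector"
    and g :: "'b \<Rightarrow> 'c::real_normed_vector"
  assumes f: "C1_map_on S f" and g: "C1_map_on T g" and ST: "f ` S \<subseteq> T"
  shows "C1_map_on S (\<lambda>x. g (f x))"
  unfolding C1_map_on_def
proof
  fix x assume x: "x \<in> S"
  obtain U F and F' :: "'a \<Rightarrow> 'a \<Rightarrow>\<^sub>L 'b" where F: "open U" "x \<in> U" "\<forall>y\<in>S \<inter> U. F y = f y"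
    "\<forall>y\<in>U. (F has_derivative blinfun_apply (F' y)) (at y)" "continuous_on U F'"
    using bspec[OF f[unfolded C1_map_on_def] x] by (elim exE conjE) (rule that)
  have fx: "f x \<in> T" using x ST by blast
  obtain V G and G' :: "'b \<Rightarrow> 'b \<Rightarrow>\<^sub>L 'c" where G: "open V" "f x \<in> V" "\<forall>y\<in>T \<inter> V. G y = g y"
    "\<forall>y\<in>V. (G has_derivative blinfun_apply (G' y)) (at y)" "continuous_on V G'"
    using bspec[OF g[unfolded C1_map_on_def] fx] by (elim exE conjE) (rule that)
  have cF: "continuous_on U F"
    using F(4) by (intro continuous_at_imp_continuous_on ballI) (rule has_derivative_continuous, erule bspec)
  define W where "W = U \<inter> F -` V"
  have W: "open W" unfolding W_def using continuous_open_preimage[OF cF F(1) G(1)] .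
  have xW: "x \<in> W" unfolding W_def using F(2,3) G(2) x by simp
  have eq: "\<forall>y\<in>S \<inter> W. (G \<circ> F) y = g (f y)"
  proof
    fix y assume y: "y \<in> S \<inter> W"
    then have "F y = f y" "F y \<in> V" "f y \<in> T" using F(3) ST unfolding W_def by auto
    then show "(G \<circ> F) y = g (f y)" using G(3) by auto
  qed
  have der: "\<forall>y\<in>W. ((G \<circ> F) has_derivative blinfun_apply (G' (F y) o\<^sub>L F' y)) (at y)"
  proof
    fix y assume "y \<in> W"
    then have "(F has_derivative blinfun_apply (F' y)) (at y)"
      "(G has_derivative blinfun_apply (G' (F y))) (at (F y))"
      using F(4) G(4) unfolding W_def by auto
    from diff_chain_at[OF this]
    show "((G \<circ> F) has_derivative blinfun_apply (G' (F y) o\<^sub>L F' y)) (at y)"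
      by (simp add: blinfun_compose.rep_eq)
  qed
  have c1: "continuous_on W F'" "continuous_on W F"
    using continuous_on_subset[OF F(5)] continuous_on_subset[OF cF] unfolding W_def by blast+
  have c2: "continuous_on W (\<lambda>y. G' (F y))"
    by (rule continuous_on_compose2[OF G(5) c1(2)]) (auto simp: W_def)
  have "continuous_on W (\<lambda>y. G' (F y) o\<^sub>L F' y)"
    by (rule bounded_bilinear.continuous_on[OF bounded_bilinear_blinfun_compose c2 c1(1)])
  then show "\<exists>U F (F' :: 'a \<Rightarrow> 'a \<Rightarrow>\<^sub>L 'c). open U \<and> x \<in> U \<and>
        (\<forall>y\<in>S \<inter> U. F y = g (f y)) \<and>
        (\<forall>y\<in>U. (F has_derivative blinfun_apply (F' y)) (at y)) \<and> continuous_on U F'"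
    using W xW eq der
    by (intro exI[of _ W] exI[of _ "G \<circ> F"] exI[of _ "\<lambda>y. G' (F y) o\<^sub>L F' y"] conjI)
qed

lemma inv_into_ident: "x \<in> S \<Longrightarrow> inv_into S (\<lambda>x\<in>S. x) x = x"
  by (rule inv_into_f_eq) (auto simp: inj_on_def)

lemma subgroup_C1_diffeos: "subgroup (C1_diffeos S) (BijGroup S)"
proof (rule group.subgroupI[OF group_BijGroup])
  show "C1_diffeos S \<subseteq> carrier (BijGroup S)"
    by (auto simp: C1_diffeos_def BijGroup_def)
  have "C1_map_on S (\<lambda>x\<in>S. x)" "C1_map_on S (inv_into S (\<lambda>x\<in>S. x))"
    using C1_map_on_ident[of S] C1_map_on_cong[of S "\<lambda>x\<in>S. x" "\<lambda>x. x"]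
      C1_map_on_cong[of S "inv_into S (\<lambda>x\<in>S. x)" "\<lambda>x. x"]
    by (simp_all add: inv_into_ident)
  then have "(\<lambda>x\<in>S. x) \<in> C1_diffeos S"
    by (simp add: C1_diffeos_def id_Bij)
  then show "C1_diffeos S \<noteq> {}" by blast
next
  fix f assume f: "f \<in> C1_diffeos S"
  then have B: "f \<in> Bij S" by (simp add: C1_diffeos_def)
  let ?i = "\<lambda>x\<in>S. inv_into S f x"
  have iB: "?i \<in> Bij S" by (rule restrict_inv_into_Bij[OF B])
  have bij: "bij_betw f S S" using B by (simp add: Bij_def)
  have "inv_into S ?i x = f x" if "x \<in> S" for x
  proof (rule inv_into_f_eq)
    show "inj_on ?i S" using iB by (simp add: Bij_def bij_betw_def)
    show "f x \<in> S" by (rule bij_betw_apply[OF bij that])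
    then show "?i (f x) = x" using bij that by (simp add: bij_betw_def)
  qed
  then have "C1_map_on S (inv_into S ?i)" "C1_map_on S ?i"
    using f C1_map_on_cong[of S "inv_into S ?i" f] C1_map_on_cong[of S ?i "inv_into S f"]
    by (simp_all add: C1_diffeos_def)
  then have "?i \<in> C1_diffeos S"
    using iB by (simp add: C1_diffeos_def)
  then show "inv\<^bsub>BijGroup S\<^esub> f \<in> C1_diffeos S"
    by (simp add: inv_BijGroup[OF B])
next
  fix f g assume fg: "f \<in> C1_diffeos S" "g \<in> C1_diffeos S"
  then have B: "f \<in> Bij S" "g \<in> Bij S" by (simp_all add: C1_diffeos_def)
  have bij: "bij_betw f S S" "bij_betw g S S" using B by (simp_all add: Bij_def)
  have cB: "compose S f g \<in> Bij S" by (rule compose_Bij[OF B])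
  have inv: "inv_into S (compose S f g) x = inv_into S g (inv_into S f x)" if "x \<in> S" for x
  proof (rule inv_into_f_eq)
    show "inj_on (compose S f g) S" using cB by (simp add: Bij_def bij_betw_def)
    have "inv_into S f x \<in> S" using bij(1) that by (simp add: bij_betw_def inv_into_into)
    then show "inv_into S g (inv_into S f x) \<in> S" using bij(2) by (simp add: bij_betw_def inv_into_into)
    then show "compose S f g (inv_into S g (inv_into S f x)) = x"
      using bij that \<open>inv_into S f x \<in> S\<close>
      by (simp add: compose_eq bij_betw_inv_into_right)
  qed
  have C1: "C1_map_on S f" "C1_map_on S g"
    "C1_map_on S (inv_into S f)" "C1_map_on S (inv_into S g)"
    using fg by (simp_all add: C1_diffeos_def)
  have "g ` S \<subseteq> S" "inv_into S f ` S \<subseteq> S"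
    using bij bij_betw_inv_into[OF bij(1)] by (simp_all add: bij_betw_def)
  then have "C1_map_on S (\<lambda>x. f (g x))"
    and "C1_map_on S (\<lambda>x. inv_into S g (inv_into S f x))"
    using C1_map_on_compose C1 by blast+
  then have "C1_map_on S (compose S f g)" "C1_map_on S (inv_into S (compose S f g))"
    using C1_map_on_cong[of S "compose S f g" "\<lambda>x. f (g x)"]
      C1_map_on_cong[of S, OF inv] by (simp_all add: compose_eq)
  then have "compose S f g \<in> C1_diffeos S"
    using cB by (simp add: C1_diffeos_def)
  then show "f \<otimes>\<^bsub>BijGroup S\<^esub> g \<in> C1_diffeos S"
    using B by (simp add: BijGroup_def)
qed

lemma group_Diff1: "group (Diff1 S)"
  unfolding Diff1_def by (rule group.subgroup_imp_group[OF group_BijGroup subgroup_C1_diffeos])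

end

theory Submission
  imports Defs "HOL-Algebra.Group_Action" "HOL-Homology.Brouwer_Degree"
begin

text \<open>
  In a group whose non-identity elements all have even order, orders are powers of 2: the odd part
  of an order would occur as the order of a power. With a bound on the orders, the group \<open>G\<close> has
  an exponent \<open>2\<^sup>N\<close>. An exponent alone does not force finiteness, since infinite finitely
  generated 2-groups of bounded exponent exist; the geometry of the sphere supplies the rest.

  Passing to a subgroup \<open>K\<close> of index at most 4, one may assume that all elements preserve
  orientation, in the sense that the Jacobian determinant is positive, and have Brouwer degree 1.
  The two conditions are used separately, which avoids proving that they are equivalent. Degree 1
  gives each element a fixed point (\<open>fixed_point_if_degree_S2\<close>), since a map without fixed points
  is homotopic to the antipodal map, of degree \<open>-1\<close>. Positive determinant makes the derivative at
  a fixed point act on the tangent plane like a rotation (\<open>eq_id_if_fixes_plane\<close>), so that fixed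
  points of a non-identity element are isolated and hence finite in number
  (\<open>finite_fixed_points\<close>).

  The derivative at \<open>p\<close> is a faithful representation of the stabilizer of \<open>p\<close> on the tangent plane
  (\<open>eq_ident_if_radial_D_eq_id\<close>). Consequently a stabilizer contains at most one involution, which
  acts as \<open>-1\<close>, and no quaternion group of order 8. For a 2-group of bounded exponent this already
  implies finiteness, because squaring is then at most two-to-one (\<open>finite_if_no_quaternions\<close>).

  From stabilizers finiteness spreads to the whole of \<open>K\<close>. The centralizer of an involution
  permutes the finitely many fixed points of that involution, so it is finite. Two involutions \<open>a,
  b\<close> either commute or both commute with the involution that is a power of \<open>a b\<close>. So all
  involutions are reached from one of them through two finite centralizers; there are finitely
  many of them, and a group in which an element has finitely many conjugates and a finite
  centralizer is finite (\<open>finite_if_finite_fixed_points\<close>).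
\<close>

section \<open>Two-groups with one involution and no quaternion subgroup\<close>

lemma (in group) inverted_pow:
  assumes "x \<in> carrier G" "w \<in> carrier G" and inv: "x \<otimes> w = inv w \<otimes> x"
  shows "x \<otimes> w [^] (n::nat) = inv (w [^] n) \<otimes> x"
proof (induction n)
  case 0
  then show ?case using assms by simp
next
  case (Suc n)
  have "x \<otimes> w [^] Suc n = (x \<otimes> w [^] n) \<otimes> w"
    using assms by (simp add: m_assoc)
  also have "\<dots> = inv (w [^] n) \<otimes> (x \<otimes> w)"
    using assms Suc by (simp add: m_assoc)
  also have "\<dots> = (inv (w [^] n) \<otimes> inv w) \<otimes> x"
    using assms by (simp add: m_assoc)
  also have "inv (w [^] n) \<otimes> inv w = inv (w [^] Suc n)"
    using assms(2) nat_pow_Suc2[OF assms(2), of n] by (simp add: inv_mult_group)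
  finally show ?case .
qed

lemma (in group) pow2: "x \<in> carrier G \<Longrightarrow> x [^] (2::nat) = x \<otimes> x"
  by (simp add: numeral_2_eq_2)

text \<open>
  The product of two involutions, or the quotient of two elements with equal squares, has a power
  of order 4 unless its own square is trivial. Repeated squaring reaches the identity, and the
  power found here is the one two squarings before that.
\<close>

lemma (in group) obtain_order_4_power:
  assumes w: "w \<in> carrier G" and k: "w [^] (2 ^ k :: nat) = \<one>" and "w [^] (2::nat) \<noteq> \<one>"
  obtains i where "w [^] (2 ^ i * 2 :: nat) \<noteq> \<one>" "w [^] (2 ^ i * 4 :: nat) = \<one>"
proof -
  define j where "j = (LEAST j. w [^] (2 ^ j :: nat) = \<one>)"
  have j: "w [^] (2 ^ j :: nat) = \<one>"
    unfolding j_def using k by (rule LeastI)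
  have "j \<noteq> 0" "j \<noteq> 1"
    using j assms(3) w by (auto intro!: gr0I) 
  then obtain i where i: "j = i + 2"
    using that[of "j - 2"] by simp
  have "w [^] (2 ^ (i + 1) :: nat) \<noteq> \<one>"
    using not_less_Least[of "i + 1" "\<lambda>j. w [^] (2 ^ j :: nat) = \<one>"] i unfolding j_def by auto
  with j show ?thesis
    by (intro that[of i]) (simp_all add: i mult.commute)
qed

lemma (in group) mult_eq_imp_mult_inv_eq:
  assumes x: "x \<in> carrier G" "y \<in> carrier G" "z \<in> carrier G" and eq: "x \<otimes> y = z \<otimes> x"
  shows "x \<otimes> inv y = inv z \<otimes> x"
proof -
  have "x \<otimes> inv y = inv z \<otimes> (z \<otimes> x) \<otimes> inv y" using x by (simp flip: m_assoc)
  also have "\<dots> = inv z \<otimes> (x \<otimes> y) \<otimes> inv y" by (simp only: eq)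
  also have "\<dots> = inv z \<otimes> x" using x by (simp add: m_assoc)
  finally show ?thesis .
qed

lemma (in group) subgroup_nat_pow_closed:
  "subgroup H G \<Longrightarrow> x \<in> H \<Longrightarrow> x [^] (n::nat) \<in> H"
  by (induction n) (simp_all add: subgroup.one_closed subgroup.m_closed)

text \<open>
  Suppose \<open>x\<^sup>2 = y\<^sup>2\<close>. Then \<open>x\<close> conjugates \<open>w = x y\<inverse>\<close> to its inverse. If \<open>w\<^sup>2 \<noteq> 1\<close>, a power \<open>q\<close> of
  \<open>w\<close> has order 4 and \<open>x\<close> inverts it as well, so \<open>x\<close> does not commute with \<open>q\<close>. In particular \<open>x\<close>
  is neither 1 nor the involution \<open>q\<^sup>2\<close>, and its order is at least 4. Take the power \<open>j\<close> of \<open>x\<close> of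
  order 4; uniqueness of the involution gives \<open>j\<^sup>2 = q\<^sup>2\<close>. If \<open>j = x\<close>, the elements \<open>x\<close> and \<open>q\<close>
  generate a quaternion group of order 8. Otherwise \<open>j\<close> is a power of \<open>x\<^sup>2\<close>, which commutes with
  \<open>q\<close>, so \<open>j q\<inverse>\<close> squares to 1 and \<open>j\<close> is \<open>q\<close> or \<open>q\<inverse>\<close>; but \<open>x\<close> commutes with its own power \<open>j\<close>.
\<close>

lemma (in group) eq_square_mult_inv_square:
  assumes H: "subgroup H G" "x \<in> H" "y \<in> H"
    and k: "\<And>g. g \<in> H \<Longrightarrow> g [^] (2 ^ k :: nat) = \<one>"
    and involution_unique: "\<And>a b. \<lbrakk>a \<in> H; b \<in> H; a [^] (2::nat) = \<one>; b [^] (2::nat) = \<one>; a \<noteq> \<one>; b \<noteq> \<one>\<rbrakk> \<Longrightarrow> a = b"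
    and no_quaternions: "\<And>a b. \<lbrakk>a \<in> H; b \<in> H; a \<otimes> b = inv b \<otimes> a; a [^] (2::nat) = b [^] (2::nat); b [^] (4::nat) = \<one>\<rbrakk>
           \<Longrightarrow> b [^] (2::nat) = \<one>"
    and xy: "x [^] (2::nat) = y [^] (2::nat)"
  shows "(x \<otimes> inv y) [^] (2::nat) = \<one>"
proof (rule ccontr)
  define w where "w = x \<otimes> inv y"
  assume "(x \<otimes> inv y) [^] (2::nat) \<noteq> \<one>"
  then have w2: "w [^] (2::nat) \<noteq> \<one>" by (simp add: w_def)
  interpret H: subgroup H G by (rule H(1))
  have x: "x \<in> carrier G" and y: "y \<in> carrier G" using H by auto
  have wH: "w \<in> H" and w: "w \<in> carrier G" using H x y by (auto simp: w_def)
  obtain i where i: "w [^] (2 ^ i * 2 :: nat) \<noteq> \<one>" "w [^] (2 ^ i * 4 :: nat) = \<one>"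
    using obtain_order_4_power[OF w k[OF wH] w2] by blast
  define q where "q = w [^] (2 ^ i :: nat)"
  have q: "q \<in> carrier G" and qH: "q \<in> H" 
    using w subgroup_nat_pow_closed[OF H(1) wH] by (simp_all add: q_def)
  have q2: "q [^] (2::nat) \<noteq> \<one>" and q4: "q [^] (4::nat) = \<one>"
    using i w by (simp_all add: q_def nat_pow_pow)
  have invert_w: "x \<otimes> w = inv w \<otimes> x"
  proof -
    have "x \<otimes> w = (x \<otimes> x) \<otimes> inv y" using x y by (simp add: w_def m_assoc)
    also have "\<dots> = y" using xy x y by (simp add: pow2 m_assoc)
    also have "y = inv w \<otimes> x" using x y by (simp add: w_def inv_mult_group m_assoc)
    finally show ?thesis .
  qed
  have invert_q: "x \<otimes> q = inv q \<otimes> x"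
    unfolding q_def by (rule inverted_pow[OF x w invert_w])
  have not_commute: "x \<otimes> q \<noteq> q \<otimes> x"
  proof
    assume "x \<otimes> q = q \<otimes> x"
    then have "q \<otimes> x = inv q \<otimes> x" using invert_q by simp
    then have "q = inv q" using q x by simp
    then have "q \<otimes> q = \<one>" using r_inv[OF q] by simp
    then show False using q2 q by (simp add: pow2)
  qed
  have q2_inv: "(q [^] (2::nat)) [^] (2::nat) = \<one>" using q4 q by (simp add: nat_pow_pow)
  have q2H: "q [^] (2::nat) \<in> H" using qH by (simp add: pow2 q)
  have q2q: "q [^] (2::nat) \<otimes> q = q \<otimes> q [^] (2::nat)" using q by (simp add: pow2 m_assoc)
  have x2: "x [^] (2::nat) \<noteq> \<one>"
  proof
    assume "x [^] (2::nat) = \<one>"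
    then have "x = \<one> \<or> x = q [^] (2::nat)"
      using involution_unique[OF H(2) q2H _ q2_inv _ q2] by blast
    then show False using not_commute q2q q by auto
  qed
  obtain m where m: "x [^] (2 ^ m * 2 :: nat) \<noteq> \<one>" "x [^] (2 ^ m * 4 :: nat) = \<one>"
    using obtain_order_4_power[OF x k[OF H(2)] x2] by blast
  define j where "j = x [^] (2 ^ m :: nat)"
  have j: "j \<in> carrier G" using x by (simp add: j_def)
  have jH: "j \<in> H" unfolding j_def using H(1,2) by (rule subgroup_nat_pow_closed)
  have j2: "j [^] (2::nat) \<noteq> \<one>" and j4: "j [^] (4::nat) = \<one>"
    using m x by (simp_all add: j_def nat_pow_pow)
  have j2H: "j [^] (2::nat) \<in> H" using jH by (simp add: pow2 j)
  have j2_inv: "(j [^] (2::nat)) [^] (2::nat) = \<one>" using j4 j by (simp add: nat_pow_pow)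
  have jq: "j [^] (2::nat) = q [^] (2::nat)"
    by (rule involution_unique[OF j2H q2H j2_inv q2_inv j2 q2])
  show False
  proof (cases m)
    case 0
    then have "j = x" using x by (simp add: j_def)
    then have "q [^] (2::nat) = \<one>"
      using no_quaternions[OF H(2) qH invert_q _ q4] jq by simp
    then show False using q2 by simp
  next
    case (Suc l)
    have x2q: "(x \<otimes> x) \<otimes> q = q \<otimes> (x \<otimes> x)"
    proof -
      have "(x \<otimes> x) \<otimes> q = x \<otimes> (inv q \<otimes> x)" using x q invert_q by (simp add: m_assoc)
      also have "\<dots> = x \<otimes> inv q \<otimes> x" using x q by (simp add: m_assoc)
      also have "x \<otimes> inv q = q \<otimes> x"
        using mult_eq_imp_mult_inv_eq[OF x q _ invert_q] q by simp
      finally show ?thesis using x q by (simp add: m_assoc)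
    qed
    have j_eq: "j = (x \<otimes> x) [^] (2 ^ l :: nat)"
      using x by (simp add: j_def Suc nat_pow_pow pow2[symmetric])
    have jq_comm: "j \<otimes> q = q \<otimes> j"
      unfolding j_eq by (rule group_commutes_pow[OF x2q]) (use x q in auto)
    have "(j \<otimes> inv q) [^] (2::nat) = j [^] (2::nat) \<otimes> inv (q [^] (2::nat))"
    proof -
      have "j \<otimes> inv q = inv q \<otimes> j"
        by (rule mult_eq_imp_mult_inv_eq[OF j q q jq_comm])
      then have "(j \<otimes> inv q) [^] (2::nat) = j [^] (2::nat) \<otimes> inv q [^] (2::nat)"
        by (rule pow_mult_distrib) (use j q in auto)
      then show ?thesis using q by (simp add: nat_pow_inv)
    qed
    then have sq: "(j \<otimes> inv q) [^] (2::nat) = \<one>" using jq q by simp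
    have "j \<otimes> inv q \<in> H" using jH qH by simp
    then have "j \<otimes> inv q = \<one> \<or> j \<otimes> inv q = q [^] (2::nat)"
      using involution_unique[OF _ q2H sq q2_inv _ q2] by blast
    then have "j = q \<or> j = q [^] (2::nat) \<otimes> q"
    proof
      assume "j \<otimes> inv q = \<one>"
      then have "j \<otimes> inv q \<otimes> q = q" using q by simp
      then show ?thesis using j q by (simp add: m_assoc)
    next
      assume "j \<otimes> inv q = q [^] (2::nat)"
      then have "j \<otimes> inv q \<otimes> q = q [^] (2::nat) \<otimes> q" by simp
      then show ?thesis using j q by (simp add: m_assoc)
    qed
    moreover have "j = inv q" if "j = q [^] (2::nat) \<otimes> q"
    proof -
      have "j \<otimes> q = q [^] (4::nat)" using that q by (simp add: pow2 m_assoc numeral_eq_Suc)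
      then show ?thesis using q4 inv_equality[of j q] j q by simp
    qed
    ultimately have "j = q \<or> j = inv q" by blast
    moreover have "x \<otimes> j = j \<otimes> x"
      unfolding j_def using x nat_pow_Suc2[OF x, of "2 ^ m"] nat_pow_Suc[of x "2 ^ m"] by simp
    ultimately have "x \<otimes> inv q = inv q \<otimes> x" using not_commute by auto
    then have "x \<otimes> inv (inv q) = inv (inv q) \<otimes> x"
      using mult_eq_imp_mult_inv_eq[of x "inv q" "inv q"] x q by blast
    then show False using not_commute q by simp
  qed
qed

lemma finite_if_finite_fibers:
  assumes "finite B" "f ` A \<subseteq> B" "\<And>y. y \<in> B \<Longrightarrow> finite {x \<in> A. f x = y}"
  shows "finite A"
proof -
  have "A \<subseteq> (\<Union>y\<in>B. {x \<in> A. f x = y})" using assms(2) by blast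
  then show ?thesis by (rule finite_subset) (use assms in auto)
qed

text \<open>
  By the previous lemma the fibre of the squaring map through \<open>y\<close> is contained in the set of
  products of \<open>y\<close> with elements of square 1, of which there are at most two. Hence squaring has
  finite fibres, and its \<open>k\<close>-th iterate collapses the whole group to the identity.
\<close>

lemma (in group) finite_if_no_quaternions:
  assumes H: "subgroup H G"
    and k: "\<And>g. g \<in> H \<Longrightarrow> g [^] (2 ^ k :: nat) = \<one>"
    and involution_unique: "\<And>a b. \<lbrakk>a \<in> H; b \<in> H; a [^] (2::nat) = \<one>; b [^] (2::nat) = \<one>; a \<noteq> \<one>; b \<noteq> \<one>\<rbrakk> \<Longrightarrow> a = b"
    and no_quaternions: "\<And>a b. \<lbrakk>a \<in> H; b \<in> H; a \<otimes> b = inv b \<otimes> a; a [^] (2::nat) = b [^] (2::nat); b [^] (4::nat) = \<one>\<rbrakk>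
           \<Longrightarrow> b [^] (2::nat) = \<one>"
  shows "finite H"
proof -
  interpret H: subgroup H G by (rule H)
  have invol: "finite {x \<in> H. x [^] (2::nat) = \<one>}"
  proof (cases "\<exists>z\<in>H. z [^] (2::nat) = \<one> \<and> z \<noteq> \<one>")
    case True
    then obtain z where "z \<in> H" "z [^] (2::nat) = \<one>" "z \<noteq> \<one>" by blast
    then have "{x \<in> H. x [^] (2::nat) = \<one>} \<subseteq> {\<one>, z}" using involution_unique by blast
    then show ?thesis by (rule finite_subset) simp
  next
    case False
    then have "{x \<in> H. x [^] (2::nat) = \<one>} \<subseteq> {\<one>}" by blast
    then show ?thesis by (rule finite_subset) simp
  qed
  have fiber: "finite {x \<in> H. x [^] (2::nat) = c}" for c
  proof (cases "\<exists>y\<in>H. y [^] (2::nat) = c")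
    case True
    then obtain y where y: "y \<in> H" "y [^] (2::nat) = c" by blast
    have "{x \<in> H. x [^] (2::nat) = c} \<subseteq> (\<lambda>w. w \<otimes> y) ` {x \<in> H. x [^] (2::nat) = \<one>}"
    proof
      fix x assume "x \<in> {x \<in> H. x [^] (2::nat) = c}"
      then have x: "x \<in> H" "x [^] (2::nat) = y [^] (2::nat)" using y by auto
      have "(x \<otimes> inv y) [^] (2::nat) = \<one>"
        by (rule eq_square_mult_inv_square[OF H x(1) y(1) k involution_unique no_quaternions x(2)])
      moreover have "x = (x \<otimes> inv y) \<otimes> y" using x(1) y(1) by (simp add: m_assoc)
      ultimately show "x \<in> (\<lambda>w. w \<otimes> y) ` {x \<in> H. x [^] (2::nat) = \<one>}"
        using x(1) y(1) by blast
    qed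
    then show ?thesis using invol by (meson finite_imageI finite_subset)
  qed (auto intro: finite_subset[of _ "{}"])
  have "finite {x \<in> H. x [^] (2 ^ j :: nat) = \<one>}" for j
  proof (induction j)
    case 0
    have "{x \<in> H. x [^] (2 ^ 0 :: nat) = \<one>} \<subseteq> {\<one>}" by auto
    then show ?case by (rule finite_subset) simp
  next
    case (Suc j)
    show ?case
    proof (rule finite_if_finite_fibers[OF Suc, of "\<lambda>x. x [^] (2::nat)"])
      show "(\<lambda>x. x [^] (2::nat)) ` {x \<in> H. x [^] (2 ^ Suc j :: nat) = \<one>}
              \<subseteq> {x \<in> H. x [^] (2 ^ j :: nat) = \<one>}"
        using subgroup_nat_pow_closed[OF H] by (auto simp: nat_pow_pow)
      show "finite {x \<in> {x \<in> H. x [^] (2 ^ Suc j :: nat) = \<one>}. x [^] (2::nat) = y}" for y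
        by (rule finite_subset[OF _ fiber[of y]]) auto
    qed
  qed
  from this[of k] show ?thesis using k by (simp cong: conj_cong)
qed

section \<open>Two-groups acting with finite fixed-point sets\<close>

text \<open>
  Point stabilizers are finite by the previous section. The centralizer of a non-identity element
  permutes the finite non-empty fixed-point set of that element, and the fibres of the evaluation
  map \<open>g \<mapsto> g p\<close> are translates of subsets of a stabilizer, so centralizers are finite too. Any two
  involutions commute with a common involution, namely one of them or a power of their product.
  The involutions therefore lie in finitely many finite centralizers, and conjugating one
  involution around the group shows that the group is finite.
\<close>

theorem (in group_action) finite_if_finite_fixed_points:
  assumes k: "\<And>g. g \<in> carrier G \<Longrightarrow> g [^] (2 ^ k :: nat) = \<one>"
    and fixed: "\<And>g. g \<in> carrier G \<Longrightarrow> g \<noteq> \<one> \<Longrightarrow> finite (invariants E \<phi> g) \<and> invariants E \<phi> g \<noteq> {}"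
    and involution_unique: "\<And>p a b. \<lbrakk>p \<in> E; a \<in> stabilizer G \<phi> p; b \<in> stabilizer G \<phi> p;
           a [^] (2::nat) = \<one>; b [^] (2::nat) = \<one>; a \<noteq> \<one>; b \<noteq> \<one>\<rbrakk> \<Longrightarrow> a = b"
    and no_quaternions: "\<And>p a b. \<lbrakk>p \<in> E; a \<in> stabilizer G \<phi> p; b \<in> stabilizer G \<phi> p;
           a \<otimes> b = inv b \<otimes> a; a [^] (2::nat) = b [^] (2::nat); b [^] (4::nat) = \<one>\<rbrakk>
           \<Longrightarrow> b [^] (2::nat) = \<one>"
  shows "finite (carrier G)"
proof -
  interpret group G using group_hom by (rule group_hom.axioms)
  have stab: "finite (stabilizer G \<phi> p)" if p: "p \<in> E" for p
  proof (rule finite_if_no_quaternions[OF stabilizer_subgroup[OF p]])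
    show "g [^] (2 ^ k :: nat) = \<one>" if "g \<in> stabilizer G \<phi> p" for g
      using that k by (simp add: stabilizer_def)
  qed (use p involution_unique no_quaternions in blast)+
  define C where "C a = {g \<in> carrier G. g \<otimes> a = a \<otimes> g}" for a
  have C: "finite (C a)" if a: "a \<in> carrier G" "a \<noteq> \<one>" for a
  proof -
    obtain p where p: "p \<in> E" "\<phi> a p = p" using fixed[OF a] by (auto simp: invariants_def)
    show ?thesis
    proof (rule finite_if_finite_fibers[where f = "\<lambda>g. \<phi> g p"])
      show "finite (invariants E \<phi> a)" using fixed[OF a] by blast
      show "(\<lambda>g. \<phi> g p) ` C a \<subseteq> invariants E \<phi> a"
      proof clarify
        fix g assume "g \<in> C a"
        then have g: "g \<in> carrier G" "g \<otimes> a = a \<otimes> g" by (auto simp: C_def)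
        have "\<phi> a (\<phi> g p) = \<phi> g (\<phi> a p)"
          using composition_rule[OF p(1)] g a by metis
        then show "\<phi> g p \<in> invariants E \<phi> a"
          using p g(1) element_image[OF g(1) p(1)] by (auto simp: invariants_def)
      qed
      show "finite {g \<in> C a. \<phi> g p = y}" for y
      proof (cases "\<exists>h\<in>C a. \<phi> h p = y")
        case True
        then obtain h where h: "h \<in> carrier G" "\<phi> h p = y" by (auto simp: C_def)
        have "{g \<in> C a. \<phi> g p = y} \<subseteq> (\<lambda>s. h \<otimes> s) ` stabilizer G \<phi> p"
        proof
          fix g assume "g \<in> {g \<in> C a. \<phi> g p = y}"
          then have g: "g \<in> carrier G" "\<phi> g p = y" by (auto simp: C_def)
          have "\<phi> (inv h \<otimes> g) p = p"
            using g h p(1) composition_rule orbit_sym_aux by simp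
          then have "inv h \<otimes> g \<in> stabilizer G \<phi> p" using g h by (simp add: stabilizer_def)
          moreover have "g = h \<otimes> (inv h \<otimes> g)" using g h by (simp flip: m_assoc)
          ultimately show "g \<in> (\<lambda>s. h \<otimes> s) ` stabilizer G \<phi> p" by blast
        qed
        then show ?thesis using stab[OF p(1)] by (meson finite_imageI finite_subset)
      qed (auto intro: finite_subset[of _ "{}"])
    qed
  qed
  define I where "I = {a \<in> carrier G. a [^] (2::nat) = \<one> \<and> a \<noteq> \<one>}"
  show ?thesis
  proof (cases "I = {}")
    case True
    then have eq_one: "x = \<one>" if "x \<in> carrier G" "x [^] (2::nat) = \<one>" for x
      using that unfolding I_def by blast
    have "x = \<one>" if "x \<in> carrier G" "x [^] (2 ^ j :: nat) = \<one>" for j x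
      using that
    proof (induction j arbitrary: x)
      case (Suc j)
      have "(x [^] (2 ^ j :: nat)) [^] (2::nat) = \<one>"
        using Suc.prems by (simp add: nat_pow_pow mult.commute)
      then have "x [^] (2 ^ j :: nat) = \<one>" using eq_one Suc.prems(1) by blast
      then show ?case by (rule Suc.IH[OF Suc.prems(1)])
    qed auto
    then have "carrier G \<subseteq> {\<one>}" using k by blast
    then show ?thesis by (rule finite_subset) simp
  next
    case False
    then obtain a where aI: "a \<in> I" by blast
    then have a: "a \<in> carrier G" "a \<otimes> a = \<one>" "a \<noteq> \<one>" by (auto simp: I_def pow2)
    have "I \<subseteq> (\<Union>z\<in>I \<inter> C a. C z)"
    proof
      fix b assume bI: "b \<in> I"
      then have b: "b \<in> carrier G" "b \<otimes> b = \<one>" "b \<noteq> \<one>" by (auto simp: I_def pow2)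
      \<comment> \<open>Both \<open>a\<close> and \<open>b\<close> invert their product \<open>w\<close>, so they centralize the involution among the powers of \<open>w\<close>.\<close>
      define w where "w = a \<otimes> b"
      have w: "w \<in> carrier G" using a b by (simp add: w_def)
      have inv_w: "inv w = b \<otimes> a"
        using a b by (simp add: w_def inv_mult_group inv_char inv_equality)
      have aw: "a \<otimes> w = inv w \<otimes> a" "b \<otimes> w = inv w \<otimes> b"
        unfolding inv_w unfolding w_def using a b
        by (simp_all add: m_assoc) (simp add: a(2) flip: m_assoc)
      show "b \<in> (\<Union>z\<in>I \<inter> C a. C z)"
      proof (cases "w [^] (2::nat) = \<one>")
        case True
        then have "inv w = w" using w by (simp add: pow2 inv_equality)
        then have "a \<otimes> b = b \<otimes> a" using inv_w by (simp add: w_def)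
        then have "a \<in> I \<inter> C a" "b \<in> C a" using aI a b by (auto simp: C_def)
        then show ?thesis by blast
      next
        case False
        obtain i where i: "w [^] (2 ^ i * 2 :: nat) \<noteq> \<one>" "w [^] (2 ^ i * 4 :: nat) = \<one>"
          using obtain_order_4_power[OF w k[OF w] False] by blast
        define z where "z = w [^] (2 ^ i * 2 :: nat)"
        have z: "z \<in> carrier G" "z \<noteq> \<one>" "z [^] (2::nat) = \<one>"
          using i w by (simp_all add: z_def nat_pow_pow mult.assoc)
        then have inv_z: "inv z = z" by (simp add: pow2 inv_equality)
        have "a \<otimes> z = inv z \<otimes> a" "b \<otimes> z = inv z \<otimes> b"
          unfolding z_def using inverted_pow a(1) b(1) w aw by blast+
        then have "z \<in> I \<inter> C a" "b \<in> C z" using z a b by (auto simp: C_def I_def inv_z)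
        then show ?thesis by blast
      qed
    qed
    moreover have "finite (\<Union>z\<in>I \<inter> C a. C z)" using C a by (auto simp: I_def)
    ultimately have I: "finite I" by (rule finite_subset)
    show ?thesis
    proof (rule finite_if_finite_fibers[OF I, of "\<lambda>g. g \<otimes> a \<otimes> inv g"])
      show "(\<lambda>g. g \<otimes> a \<otimes> inv g) ` carrier G \<subseteq> I"
      proof clarify
        fix g assume g: "g \<in> carrier G"
        have "(g \<otimes> a \<otimes> inv g) \<otimes> (g \<otimes> a \<otimes> inv g) = g \<otimes> (a \<otimes> (inv g \<otimes> g) \<otimes> a) \<otimes> inv g"
          using g a(1) by (simp only: m_assoc m_closed inv_closed)
        also have "\<dots> = \<one>" using g a by (simp del: inv_solve_right)
        finally have "(g \<otimes> a \<otimes> inv g) \<otimes> (g \<otimes> a \<otimes> inv g) = \<one>" .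
        moreover have "g \<otimes> a \<otimes> inv g \<noteq> \<one>"
        proof
          assume "g \<otimes> a \<otimes> inv g = \<one>"
          then have "g \<otimes> a \<otimes> inv g \<otimes> g = g" using g by simp
          then have "g \<otimes> a = g" using g a by (simp add: m_assoc)
          then show False using g a by simp
        qed
        ultimately show "g \<otimes> a \<otimes> inv g \<in> I" using g a by (simp add: I_def pow2)
      qed
      fix y
      show "finite {g \<in> carrier G. g \<otimes> a \<otimes> inv g = y}"
      proof (cases "\<exists>h\<in>carrier G. h \<otimes> a \<otimes> inv h = y")
        case True
        then obtain h where h: "h \<in> carrier G" "h \<otimes> a \<otimes> inv h = y" by blast
        have "{g \<in> carrier G. g \<otimes> a \<otimes> inv g = y} \<subseteq> (\<lambda>s. h \<otimes> s) ` C a"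
        proof
          fix g assume "g \<in> {g \<in> carrier G. g \<otimes> a \<otimes> inv g = y}"
          then have g: "g \<in> carrier G" "g \<otimes> a \<otimes> inv g = h \<otimes> a \<otimes> inv h" using h by auto
          have "inv h \<otimes> g \<otimes> a = inv h \<otimes> (g \<otimes> a \<otimes> inv g) \<otimes> g"
            using g(1) h(1) a(1) by (simp add: m_assoc)
          also have "\<dots> = inv h \<otimes> (h \<otimes> a \<otimes> inv h) \<otimes> g" using g by simp
          also have "\<dots> = (inv h \<otimes> h) \<otimes> a \<otimes> (inv h \<otimes> g)"
            using g(1) h(1) a(1) by (simp only: m_assoc m_closed inv_closed)
          also have "\<dots> = a \<otimes> (inv h \<otimes> g)" using g(1) h(1) a by simp
          finally have "inv h \<otimes> g \<in> C a" using g h by (simp add: C_def)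
          moreover have "g = h \<otimes> (inv h \<otimes> g)" using g h by (simp flip: m_assoc)
          ultimately show "g \<in> (\<lambda>s. h \<otimes> s) ` C a" by blast
        qed
        then show ?thesis using C[OF a(1,3)] by (meson finite_imageI finite_subset)
      qed (auto intro: finite_subset[of _ "{}"])
    qed
  qed
qed

section \<open>Linear maps of finite order that fix a vector\<close>

lemma orthonormal_expansion3:
  fixes p v :: "real^3"
  assumes p: "p \<bullet> p = 1" and v: "v \<bullet> v = 1" and pv: "p \<bullet> v = 0"
  shows "h = (p \<bullet> h) *\<^sub>R p + (v \<bullet> h) *\<^sub>R v + (cross3 p v \<bullet> h) *\<^sub>R cross3 p v"
proof -
  define w where "w = cross3 p v"
  have w: "w \<bullet> w = 1" "p \<bullet> w = 0" "v \<bullet> w = 0"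
    using p v pv by (simp_all add: w_def dot_cross dot_cross_self inner_commute)
  have n: "p \<noteq> 0" "v \<noteq> 0" "w \<noteq> 0" using p v w by auto
  define d where "d = h - ((p \<bullet> h) *\<^sub>R p + (v \<bullet> h) *\<^sub>R v + (w \<bullet> h) *\<^sub>R w)"
  have d: "p \<bullet> d = 0" "v \<bullet> d = 0" "w \<bullet> d = 0"
    using p v pv w by (simp_all add: d_def inner_simps inner_commute)
  have "cross3 (cross3 p v) d = 0"
    using d(1,2) by (simp add: cross_skew[of "cross3 p v"] Lagrange inner_commute)
  then have "(norm (cross3 w d))\<^sup>2 = 0" by (simp add: w_def)
  then have "(norm w)\<^sup>2 * (norm d)\<^sup>2 = 0" using d(3) by (simp add: norm_cross)
  then have "d = 0" using n by simp
  then show ?thesis by (simp add: d_def w_def)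
qed

text \<open>
  The derivative of an orientation-preserving periodic map of the sphere at a fixed point \<open>p\<close>,
  extended to fix the vector \<open>p\<close> itself, is a map \<open>A\<close> of this kind. Such a map behaves like a
  rotation: in an orthonormal basis \<open>p, u, w\<close> of which \<open>p\<close> and \<open>u\<close> are fixed, \<open>w\<close> is sent to \<open>b u
  + c w\<close> with \<open>c\<close> the determinant. Positivity and finite order force \<open>c = 1\<close>, and then the shear
  \<open>b\<close> accumulates under iteration unless it vanishes.
\<close>

lemma eq_id_if_fixes_plane:
  fixes A :: "real^3 \<Rightarrow> real^3"
  assumes lin: "linear A" and p: "norm p = 1" and Ap: "A p = p"
    and tangent: "\<And>h. p \<bullet> A h = p \<bullet> h"
    and det: "det (matrix A) > 0" and n: "n > 0" "\<And>h. (A ^^ n) h = h"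
    and v: "A v = v" "v \<noteq> (p \<bullet> v) *\<^sub>R p"
  shows "A h = h"
proof -
  interpret linear A by (rule lin)
  define u0 where "u0 = v - (p \<bullet> v) *\<^sub>R p"
  have pp: "p \<bullet> p = 1" using p by (simp add: norm_eq_1)
  have u0: "u0 \<noteq> 0" "A u0 = u0" "p \<bullet> u0 = 0"
    using v Ap pp by (simp_all add: u0_def diff scaleR inner_simps)
  define u where "u = u0 /\<^sub>R norm u0"
  have u: "u \<bullet> u = 1" "A u = u" "p \<bullet> u = 0"
    using u0 by (simp_all add: u_def scaleR dot_square_norm power2_eq_square)
  define w where "w = cross3 p u"
  have w: "w \<bullet> w = 1" "p \<bullet> w = 0" "u \<bullet> w = 0"
    using pp u by (simp_all add: w_def dot_cross dot_cross_self inner_commute)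
  define b c where "b = u \<bullet> A w" and "c = w \<bullet> A w"
  have Aw: "A w = b *\<^sub>R u + c *\<^sub>R w"
    using orthonormal_expansion3[OF pp u(1,3), of "A w"] tangent[of w] w(2)
    by (simp add: b_def c_def flip: w_def)
  have mat: "matrix A *v x = A x" for x using lin by (simp add: matrix_works)
  have "A p \<bullet> cross3 (A u) (A w) = (matrix A *v p) \<bullet> cross3 (matrix A *v u) (matrix A *v w)"
    by (simp only: mat)
  also have "\<dots> = p \<bullet> (transpose (matrix A) *v cross3 (matrix A *v u) (matrix A *v w))"
    using dot_lmul_matrix[of "cross3 (matrix A *v u) (matrix A *v w)" "matrix A" p]
    by (simp add: inner_commute)
  also have "\<dots> = det (matrix A) * (p \<bullet> cross3 u w)"
    unfolding cross_matrix_mult by simp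
  finally have "c * (p \<bullet> cross3 u w) = det (matrix A) * (p \<bullet> cross3 u w)"
    by (simp add: Ap u Aw cross_add_right cross_mult_right)
  moreover have "p \<bullet> cross3 u w = 1"
    using w(1) cross_triple[of p u w] by (simp add: w_def inner_commute)
  ultimately have "c > 0" using det by simp
  have pow: "(A ^^ m) w = (b * (\<Sum>i<m. c ^ i)) *\<^sub>R u + (c ^ m) *\<^sub>R w" for m
  proof (induction m)
    case (Suc m)
    then show ?case
      by (simp add: add scaleR u Aw scaleR_add_right flip: scaleR_add_left)
         (simp add: algebra_simps)
  qed simp
  have eq: "w = (b * (\<Sum>i<n. c ^ i)) *\<^sub>R u + (c ^ n) *\<^sub>R w" using pow[of n] n by simp
  have coord: "w \<bullet> (x *\<^sub>R u + y *\<^sub>R w) = y" "u \<bullet> (x *\<^sub>R u + y *\<^sub>R w) = x" for x y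
    using w u by (simp_all add: inner_add_right inner_commute[of w u])
  have "w \<bullet> w = c ^ n" "u \<bullet> w = b * (\<Sum>i<n. c ^ i)"
    using arg_cong[OF eq, of "(\<bullet>) w"] arg_cong[OF eq, of "(\<bullet>) u"] unfolding coord by blast+
  then have "c ^ n = 1" "b * (\<Sum>i<n. c ^ i) = 0"
    using w by simp_all
  then have "c = 1" using \<open>c > 0\<close> n(1) power_eq_1_iff[of c n] by simp
  then have "b = 0" using \<open>b * (\<Sum>i<n. c ^ i) = 0\<close> n(1) by simp
  have "A w = w" using Aw \<open>b = 0\<close> \<open>c = 1\<close> by simp
  have h: "h = (p \<bullet> h) *\<^sub>R p + (u \<bullet> h) *\<^sub>R u + (w \<bullet> h) *\<^sub>R w"
    using orthonormal_expansion3[OF pp u(1,3), of h] by (simp flip: w_def)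
  have "A ((p \<bullet> h) *\<^sub>R p + (u \<bullet> h) *\<^sub>R u + (w \<bullet> h) *\<^sub>R w) = (p \<bullet> h) *\<^sub>R p + (u \<bullet> h) *\<^sub>R u + (w \<bullet> h) *\<^sub>R w"
    by (simp add: add scaleR Ap u \<open>A w = w\<close>)
  then show ?thesis by (simp only: h[symmetric])
qed

text \<open>
  For a tangent vector \<open>v\<close> the vectors \<open>v, J v\<close> span the plane because a map with square \<open>-1\<close> has
  no real eigenvalue. Writing \<open>Q v = r v + s J v\<close>, anticommutation gives \<open>Q\<^sup>2 v = (r\<^sup>2 + s\<^sup>2) v\<close>,
  which cannot be \<open>-v\<close>. In other words, the quaternion group of order 8 does not act faithfully on
  a real plane.
\<close>

lemma no_quaternions_on_plane:
  fixes J Q :: "real^3 \<Rightarrow> real^3"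
  assumes lin: "linear J" "linear Q" and p: "norm p = 1"
    and tangent: "\<And>h. p \<bullet> h = 0 \<Longrightarrow> p \<bullet> J h = 0" "\<And>h. p \<bullet> h = 0 \<Longrightarrow> p \<bullet> Q h = 0"
    and J2: "\<And>h. p \<bullet> h = 0 \<Longrightarrow> J (J h) = - h" and Q2: "\<And>h. p \<bullet> h = 0 \<Longrightarrow> Q (Q h) = - h"
    and anti: "\<And>h. p \<bullet> h = 0 \<Longrightarrow> J (Q h) = - Q (J h)"
  shows False
proof -
  interpret J: linear J by (rule lin)
  interpret Q: linear Q by (rule lin)
  have pp: "p \<bullet> p = 1" using p by (simp add: norm_eq_1)
  obtain v0 :: "real^3" where v0: "v0 \<noteq> 0" "orthogonal p v0"
    using orthogonal_to_vector_exists[of p] by auto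
  define v where "v = v0 /\<^sub>R norm v0"
  have v: "v \<bullet> v = 1" "p \<bullet> v = 0"
    using v0 by (simp_all add: v_def orthogonal_def dot_square_norm power2_eq_square)
  define w where "w = cross3 p v"
  define a b c d where "a = v \<bullet> J v" "b = w \<bullet> J v" "c = v \<bullet> Q v" "d = w \<bullet> Q v"
  have Jv: "J v = a *\<^sub>R v + b *\<^sub>R w"
    using orthonormal_expansion3[OF pp v, of "J v"] tangent(1)[OF v(2)]
    by (simp add: a_b_c_d_def flip: w_def)
  have Qv: "Q v = c *\<^sub>R v + d *\<^sub>R w"
    using orthonormal_expansion3[OF pp v, of "Q v"] tangent(2)[OF v(2)]
    by (simp add: a_b_c_d_def flip: w_def)
  have "v \<noteq> 0" using v by auto
  have "b \<noteq> 0"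
  proof
    assume "b = 0"
    then have "J v = a *\<^sub>R v" using Jv by simp
    then have "(a * a) *\<^sub>R v = - v" using J2[OF v(2)] by (simp add: J.scaleR)
    then have "v \<bullet> ((a * a) *\<^sub>R v) = v \<bullet> - v" by simp
    then have "a * a = -1" using v(1) by simp
    then show False using zero_le_square[of a] by linarith
  qed
  define r s where "r = c - d * a / b" and "s = d / b"
  have Q: "Q v = r *\<^sub>R v + s *\<^sub>R J v"
    using \<open>b \<noteq> 0\<close> unfolding Jv Qv r_def s_def by (simp add: algebra_simps)
  have "- v = Q (r *\<^sub>R v + s *\<^sub>R J v)" using Q2[OF v(2)] Q by simp
  also have "\<dots> = r *\<^sub>R Q v + s *\<^sub>R Q (J v)" by (simp add: Q.add Q.scaleR)
  also have "Q (J v) = - J (Q v)" using anti[OF v(2)] by simp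
  also have "J (Q v) = r *\<^sub>R J v - s *\<^sub>R v" unfolding Q by (simp add: J.add J.scaleR J2 v)
  finally have "- v = (r * r + s * s) *\<^sub>R v" unfolding Q by (simp add: algebra_simps)
  then have "v \<bullet> (- v) = v \<bullet> ((r * r + s * s) *\<^sub>R v)" by simp
  then have "r * r + s * s = -1" using v(1) by simp
  then show False using zero_le_square[of r] zero_le_square[of s] by linarith
qed

section \<open>The radial extension of a map of the sphere\<close>

text \<open>
  Extending a map of the unit sphere homogeneously of degree 1 replaces charts: a \<open>C\<^sup>1\<close> map of the
  sphere becomes a \<open>C\<^sup>1\<close> map of the punctured space, composition is preserved, and the derivative
  at a point of the sphere is an endomorphism of the whole space that contains the tangent map.
\<close>

definition radial_ext :: "('a::real_normed_vector \<Rightarrow> 'b::real_normed_vector) \<Rightarrow> 'a \<Rightarrow> 'b" where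
  "radial_ext f x = norm x *\<^sub>R f (sgn x)"

abbreviation radial_D :: "('a::real_normed_vector \<Rightarrow> 'b::real_normed_vector) \<Rightarrow> 'a \<Rightarrow> 'a \<Rightarrow> 'b" where
  "radial_D f x \<equiv> frechet_derivative (radial_ext f) (at x)"

lemma radial_ext_sphere: "x \<in> sphere 0 1 \<Longrightarrow> radial_ext f x = f x"
  by (simp add: radial_ext_def sgn_div_norm)

lemma radial_ext_cong:
  assumes "\<And>x. x \<in> sphere 0 1 \<Longrightarrow> f x = g x"
  shows "radial_ext f = radial_ext g"
proof
  fix x show "radial_ext f x = radial_ext g x"
    using assms[of "sgn x"] by (cases "x = 0") (simp_all add: radial_ext_def norm_sgn)
qed

lemma radial_ext_ident: "radial_ext (\<lambda>x. x) = id"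
proof
  show "radial_ext (\<lambda>x. x) x = id x" for x :: 'a
    by (cases "x = 0") (simp_all add: radial_ext_def sgn_div_norm)
qed

lemma norm_radial_ext:
  assumes "f ` sphere 0 1 \<subseteq> sphere 0 1"
  shows "norm (radial_ext f x) = norm x"
proof (cases "x = 0")
  case False
  then have "sgn x \<in> sphere 0 1" by (simp add: norm_sgn)
  then have "f (sgn x) \<in> sphere 0 1" using assms by blast
  then show ?thesis by (simp add: radial_ext_def)
qed (simp add: radial_ext_def)

lemma radial_ext_compose:
  assumes "g ` sphere 0 1 \<subseteq> sphere 0 1"
  shows "radial_ext (\<lambda>x. f (g x)) = radial_ext f \<circ> radial_ext g"
proof
  fix x
  show "radial_ext (\<lambda>x. f (g x)) x = (radial_ext f \<circ> radial_ext g) x"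
  proof (cases "x = 0")
    case False
    then have "norm (g (sgn x)) = 1" using assms by (simp add: image_subset_iff norm_sgn)
    then have "sgn (radial_ext g x) = g (sgn x)"
      using False by (simp add: radial_ext_def sgn_scaleR) (simp add: sgn_div_norm)
    then show ?thesis using norm_radial_ext[OF assms, of x] by (simp add: radial_ext_def)
  qed (simp add: radial_ext_def)
qed

lemma has_derivative_sgn:
  fixes x :: "'a::real_inner"
  assumes "x \<noteq> 0"
  shows "(sgn has_derivative (\<lambda>h. (h - (sgn x \<bullet> h) *\<^sub>R sgn x) /\<^sub>R norm x)) (at x)"
proof -
  have "norm x \<noteq> 0" using assms by simp
  note der = has_derivative_scaleR[OF Deriv.has_derivative_inverse[OF this has_derivative_norm[OF assms]] has_derivative_ident]
  have "((\<lambda>x. x /\<^sub>R norm x) has_derivative (\<lambda>h. (h - (sgn x \<bullet> h) *\<^sub>R sgn x) /\<^sub>R norm x)) (at x)"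
    by (rule has_derivative_eq_rhs[OF der]) (simp add: fun_eq_iff sgn_div_norm algebra_simps inner_commute)
  then show ?thesis by (simp add: sgn_div_norm[abs_def])
qed

lemma C1_radial_ext:
  fixes f :: "'a::euclidean_space \<Rightarrow> 'b::euclidean_space"
  assumes f: "C1_map_on (sphere 0 1) f"
  shows has_derivative_radial_ext: "x \<noteq> 0 \<Longrightarrow> (radial_ext f has_derivative radial_D f x) (at x)"
    and continuous_on_radial_D: "continuous_on (- {0}) (\<lambda>x. radial_D f x h)"
proof -
  have local: "\<exists>W. open W \<and> x0 \<in> W \<and> (\<forall>x\<in>W. (radial_ext f has_derivative radial_D f x) (at x)) \<and>
       (\<forall>h. continuous_on W (\<lambda>x. radial_D f x h))" if x0: "x0 \<noteq> 0" for x0 :: 'a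
  proof -
    have sx0: "sgn x0 \<in> sphere 0 1" using x0 by (simp add: norm_sgn)
    obtain U F and F' :: "'a \<Rightarrow> 'a \<Rightarrow>\<^sub>L 'b" where
      F: "open U" "sgn x0 \<in> U" "\<forall>y\<in>sphere 0 1 \<inter> U. F y = f y"
      "\<forall>y\<in>U. (F has_derivative blinfun_apply (F' y)) (at y)" "continuous_on U F'"
      using bspec[OF f[unfolded C1_map_on_def] sx0] by (elim exE conjE) (rule that)
    have cF: "continuous_on U F"
      using F(4) by (intro continuous_at_imp_continuous_on ballI) (rule has_derivative_continuous, erule bspec)
    define W where "W = {x \<in> - {0}. sgn x \<in> U}"
    have cs: "continuous_on (- {0}) (sgn :: 'a \<Rightarrow> 'a)"
      by (intro continuous_intros) auto
    have W: "open W"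
    proof -
      have "W = - {0} \<inter> sgn -` U" by (auto simp: W_def)
      moreover have "open (- {0 :: 'a})" by (rule open_Compl) simp
      ultimately show ?thesis using continuous_open_preimage[OF cs _ F(1)] by simp
    qed
    define E where "E x h = norm x *\<^sub>R F' (sgn x) ((h - (sgn x \<bullet> h) *\<^sub>R sgn x) /\<^sub>R norm x)
          + (h \<bullet> sgn x) *\<^sub>R F (sgn x)" for x h
    have der: "(radial_ext f has_derivative E x) (at x)" if x: "x \<in> W" for x
    proof -
      have nz: "x \<noteq> 0" and U: "sgn x \<in> U" using x by (auto simp: W_def)
      have 1: "((\<lambda>x. F (sgn x)) has_derivative (\<lambda>h. F' (sgn x) ((h - (sgn x \<bullet> h) *\<^sub>R sgn x) /\<^sub>R norm x))) (at x)"
        using diff_chain_at[OF has_derivative_sgn[OF nz], of F "blinfun_apply (F' (sgn x))"] F(4) U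
        by (simp add: o_def)
      have "((\<lambda>x. norm x *\<^sub>R F (sgn x)) has_derivative E x) (at x)"
        unfolding E_def[abs_def]
        by (rule has_derivative_scaleR[OF has_derivative_norm[OF nz] 1])
      then show ?thesis
      proof (rule has_derivative_transform_within_open[OF _ W x])
        fix y assume "y \<in> W"
        then have "sgn y \<in> sphere 0 1 \<inter> U" by (auto simp: W_def norm_sgn)
        then show "norm y *\<^sub>R F (sgn y) = radial_ext f y"
          using F(3) by (simp add: radial_ext_def)
      qed
    qed
    have eq: "radial_D f x = E x" if "x \<in> W" for x
      using frechet_derivative_at[OF der[OF that]] by simp
    have WW: "W \<subseteq> - {0}" "sgn ` W \<subseteq> U" by (auto simp: W_def)
    have csW: "continuous_on W (sgn :: 'a \<Rightarrow> 'a)" using cs WW(1) by (rule continuous_on_subset)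
    have c1: "continuous_on W (\<lambda>x. F (sgn x))" "continuous_on W (\<lambda>x. F' (sgn x))"
      using continuous_on_compose2[OF cF csW WW(2)] continuous_on_compose2[OF F(5) csW WW(2)] by auto
    have "continuous_on W (\<lambda>x. E x h)" for h
      unfolding E_def using WW(1)
      by (intro continuous_intros c1 csW blinfun.continuous_on) auto
    moreover have "continuous_on W (\<lambda>x. E x h) = continuous_on W (\<lambda>x. radial_D f x h)" for h
      by (rule continuous_on_cong) (auto simp: eq)
    ultimately show ?thesis
      using W x0 F(2) der eq by (intro exI[of _ W]) (auto simp: W_def)
  qed
  show "(radial_ext f has_derivative radial_D f x) (at x)" if "x \<noteq> 0" for x
    using local[OF that] by blast
  show "continuous_on (- {0}) (\<lambda>x. radial_D f x h)" for h
  proof (rule continuous_at_imp_continuous_on, rule ballI)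
    fix x :: 'a assume "x \<in> - {0}"
    then obtain W where "open W" "x \<in> W" "continuous_on W (\<lambda>x. radial_D f x h)"
      using local[of x] by auto
    then show "isCont (\<lambda>x. radial_D f x h) x" by (simp add: continuous_on_eq_continuous_at)
  qed
qed

lemma linear_radial_D:
  fixes f :: "'a::euclidean_space \<Rightarrow> 'b::euclidean_space"
  assumes "C1_map_on (sphere 0 1) f" "x \<noteq> 0"
  shows "linear (radial_D f x)"
  using has_derivative_linear[OF has_derivative_radial_ext[OF assms]] .

lemma radial_D_compose:
  fixes f g :: "'a::euclidean_space \<Rightarrow> 'a"
  assumes f: "C1_map_on (sphere 0 1) f" and g: "C1_map_on (sphere 0 1) g"
    and gS: "g ` sphere 0 1 \<subseteq> sphere 0 1" and x: "x \<in> sphere 0 1"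
  shows "radial_D (\<lambda>x. f (g x)) x = radial_D f (g x) \<circ> radial_D g x"
proof -
  have "g x \<in> sphere 0 1" using gS x by blast
  then have nz: "x \<noteq> 0" "g x \<noteq> 0" using x by auto
  have "(radial_ext f \<circ> radial_ext g has_derivative radial_D f (g x) \<circ> radial_D g x) (at x)"
    using has_derivative_radial_ext[OF g nz(1)] has_derivative_radial_ext[OF f nz(2)]
    by (intro diff_chain_at) (simp_all add: radial_ext_sphere[OF x])
  from frechet_derivative_at[OF this] show ?thesis
    by (simp add: radial_ext_compose[OF gS])
qed

text \<open>
  In the radial direction the derivative is determined by homogeneity, and by the next lemma it
  maps tangent vectors to tangent vectors because the radial extension preserves the norm.
\<close>

lemma radial_D_radial:
  fixes f :: "'a::euclidean_space \<Rightarrow> 'b::euclidean_space"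
  assumes f: "C1_map_on (sphere 0 1) f" and x: "x \<in> sphere 0 1"
  shows "radial_D f x x = f x"
proof -
  have nz: "x \<noteq> 0" using x by auto
  have scale: "((\<lambda>c. c *\<^sub>R x) has_derivative (\<lambda>h. h *\<^sub>R x)) (at (1::real))"
    by (rule bounded_linear_imp_has_derivative[OF bounded_linear_scaleR_left])
  have "((\<lambda>c. radial_ext f (c *\<^sub>R x)) has_derivative (\<lambda>h. radial_D f x (h *\<^sub>R x))) (at (1::real))"
    using diff_chain_at[OF scale, of "radial_ext f" "radial_D f x"]
      has_derivative_radial_ext[OF f nz] by (simp add: o_def)
  moreover have "((\<lambda>c. radial_ext f (c *\<^sub>R x)) has_derivative (\<lambda>h. h *\<^sub>R f x)) (at (1::real))"
  proof (rule has_derivative_transform_within_open[of "\<lambda>c. c *\<^sub>R f x" _ _ _ "{0<..}"])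
    show "((\<lambda>c. c *\<^sub>R f x) has_derivative (\<lambda>h. h *\<^sub>R f x)) (at (1::real))"
      by (auto intro!: derivative_eq_intros)
    show "c *\<^sub>R f x = radial_ext f (c *\<^sub>R x)" if "c \<in> {0<..}" for c
      using that x by (simp add: radial_ext_def sgn_scaleR) (simp add: sgn_div_norm)
  qed auto
  ultimately have "(\<lambda>h. radial_D f x (h *\<^sub>R x)) = (\<lambda>h. h *\<^sub>R f x)"
    by (rule has_derivative_unique)
  from fun_cong[OF this, of 1] show ?thesis by simp
qed

lemma inner_radial_D:
  fixes f :: "'a::euclidean_space \<Rightarrow> 'b::euclidean_space"
  assumes f: "C1_map_on (sphere 0 1) f" and fS: "f ` sphere 0 1 \<subseteq> sphere 0 1" and x: "x \<in> sphere 0 1"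
  shows "f x \<bullet> radial_D f x h = x \<bullet> h"
proof -
  have nz: "x \<noteq> 0" using x by auto
  note der = has_derivative_radial_ext[OF f nz]
  have "((\<lambda>y. radial_ext f y \<bullet> radial_ext f y) has_derivative (\<lambda>h. 2 * (f x \<bullet> radial_D f x h))) (at x)"
    using has_derivative_inner[OF der der] by (simp add: radial_ext_sphere[OF x] inner_commute)
  moreover have "(\<lambda>y. radial_ext f y \<bullet> radial_ext f y) = (\<lambda>y :: 'a. y \<bullet> y)"
    by (rule ext) (simp add: dot_square_norm norm_radial_ext[OF fS])
  moreover have "((\<lambda>y :: 'a. y \<bullet> y) has_derivative (\<lambda>h. 2 * (x \<bullet> h))) (at x)"
    by (auto intro!: derivative_eq_intros simp: inner_commute)
  ultimately have "((\<lambda>y :: 'a. y \<bullet> y) has_derivative (\<lambda>h. 2 * (f x \<bullet> radial_D f x h))) (at x)"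
    "((\<lambda>y :: 'a. y \<bullet> y) has_derivative (\<lambda>h. 2 * (x \<bullet> h))) (at x)" by simp_all
  then have "(\<lambda>h. 2 * (f x \<bullet> radial_D f x h)) = (\<lambda>h. 2 * (x \<bullet> h))"
    by (rule has_derivative_unique)
  from fun_cong[OF this, of h] show ?thesis by simp
qed

section \<open>Periodic maps near a fixed point\<close>

lemma locally_injective_if_inj_derivative:
  fixes \<Phi> :: "'a::euclidean_space \<Rightarrow> 'a"
  assumes U: "open U" "a \<in> U"
    and der: "\<And>x. x \<in> U \<Longrightarrow> (\<Phi> has_derivative \<Phi>' x) (at x)"
    and cont: "\<And>h. continuous_on U (\<lambda>x. \<Phi>' x h)"
    and inj: "inj (\<Phi>' a)"
  obtains r where "r > 0" "inj_on \<Phi> (ball a r)"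
proof -
  have bl: "bounded_linear (\<Phi>' x)" if "x \<in> U" for x
    using has_derivative_bounded_linear[OF der[OF that]] .
  define L where "L x = Blinfun (\<Phi>' x)" for x
  have L: "blinfun_apply (L x) = \<Phi>' x" if "x \<in> U" for x
    unfolding L_def using bl[OF that] by (rule bounded_linear_Blinfun_apply)
  have "continuous_on U (\<lambda>x. L x h)" for h
    using cont[of h] by (rule continuous_on_eq) (simp add: L)
  then have cL: "continuous_on U L" by (intro continuous_on_blinfun_componentwise)
  obtain g' where g': "linear g'" "g' \<circ> \<Phi>' a = id"
    using linear_injective_left_inverse[OF _ inj] bounded_linear.linear[OF bl[OF U(2)]] by blast
  show ?thesis
  proof (rule has_derivative_locally_injective[of a U g' \<Phi>' \<Phi>])
    show "bounded_linear g'" using g'(1) by (rule linear_conv_bounded_linear[THEN iffD1])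
    fix e :: real assume e: "e > 0"
    obtain d1 where d1: "d1 > 0" "ball a d1 \<subseteq> U" using U open_contains_ball by blast
    obtain d2 where d2: "d2 > 0" "\<And>x. x \<in> U \<Longrightarrow> dist x a < d2 \<Longrightarrow> dist (L x) (L a) < e"
      using cL U(2) e unfolding continuous_on_iff by blast
    show "\<exists>d>0. \<forall>x. dist a x < d \<longrightarrow> onorm (\<lambda>v. \<Phi>' x v - \<Phi>' a v) < e"
    proof (intro exI[of _ "min d1 d2"] conjI allI impI)
      fix x assume x: "dist a x < min d1 d2"
      then have xU: "x \<in> U" using d1 by auto
      have "onorm (\<lambda>v. \<Phi>' x v - \<Phi>' a v) = dist (L x) (L a)"
        by (simp add: dist_norm norm_blinfun.rep_eq minus_blinfun.rep_eq L[OF xU] L[OF U(2)])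
      also have "\<dots> < e" using d2(2)[OF xU] x by (simp add: dist_commute)
      finally show "onorm (\<lambda>v. \<Phi>' x v - \<Phi>' a v) < e" .
    qed (use d1 d2 in auto)
  qed (use assms g' that in auto)
qed

lemma C1_map_on_funpow:
  assumes "C1_map_on S f" "f ` S \<subseteq> S"
  shows "C1_map_on S (f ^^ i)" "(f ^^ i) ` S \<subseteq> S"
proof -
  show 2: "(f ^^ i) ` S \<subseteq> S" for i
    using assms(2) by (induction i) (auto simp: image_subset_iff)
  show "C1_map_on S (f ^^ i)"
  proof (induction i)
    case 0
    then show ?case using C1_map_on_ident by (simp add: id_def)
  next
    case (Suc i)
    then show ?case using C1_map_on_compose[OF Suc assms(1) 2] by (simp add: o_def)
  qed
qed

lemma radial_D_funpow:
  fixes f :: "'a::euclidean_space \<Rightarrow> 'a"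
  assumes f: "C1_map_on (sphere 0 1) f" "f ` sphere 0 1 \<subseteq> sphere 0 1" and x: "x \<in> sphere 0 1" "f x = x"
  shows "radial_D (f ^^ i) x = radial_D f x ^^ i"
proof (induction i)
  case 0
  have "radial_D (\<lambda>x. x) x = id"
    unfolding radial_ext_ident using frechet_derivative_at[OF has_derivative_id] by (simp add: id_def)
  then show ?case by (simp add: id_def)
next
  case (Suc i)
  have "(f ^^ i) x = x" using x(2) by (induction i) auto
  then show ?case
    using radial_D_compose[OF f(1) C1_map_on_funpow[OF f] x(1), of i] Suc by (simp add: o_def)
qed

text \<open>
  Near a fixed point \<open>x\<close> with identity derivative the sum \<open>\<Phi>\<close> of the iterates \<open>F\<^sup>0, \<dots>, F\<^sup>n\<^sup>-\<^sup>1\<close> of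
  the radial extension has derivative \<open>n\<close> times the identity, so it is injective, and it is
  invariant under \<open>F\<close> since \<open>F\<^sup>n\<close> is the identity. Hence \<open>F\<close> is the identity near \<open>x\<close>. The set of
  fixed points with identity derivative is thus open, and it is closed by continuity of the
  derivative; the sphere is connected.
\<close>

lemma eq_ident_if_radial_D_eq_id:
  fixes f :: "'a::euclidean_space \<Rightarrow> 'a"
  assumes dim: "2 \<le> DIM('a)"
    and f: "C1_map_on (sphere 0 1) f" "f ` sphere 0 1 \<subseteq> sphere 0 1"
    and n: "n > 0" "\<And>x. x \<in> sphere 0 1 \<Longrightarrow> (f ^^ n) x = x"
    and p: "p \<in> sphere 0 1" "f p = p" "radial_D f p = id"
    and x: "x \<in> sphere 0 1"
  shows "f x = x"
proof -
  let ?S = "sphere 0 1 :: 'a set"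
  define E where "E = {x \<in> ?S. f x = x \<and> radial_D f x = id}"
  note fi = C1_map_on_funpow[OF f]
  define F where "F i = radial_ext (f ^^ i)" for i
  have FF: "F i (radial_ext f y) = F (Suc i) y" for i y
    using radial_ext_compose[OF f(2), of "f ^^ i"] by (simp add: F_def funpow_swap1 o_def fun_eq_iff)
  have Fn: "F n = F 0"
    unfolding F_def by (rule radial_ext_cong) (simp add: n(2))
  have cont: "isCont (radial_ext f) y" if "y \<noteq> 0" for y
    using has_derivative_continuous[OF has_derivative_radial_ext[OF f(1) that]] .
  have "\<exists>r>0. \<forall>y\<in>ball x r. y \<noteq> 0 \<and> radial_ext f y = y" if "x \<in> E" for x
  proof -
    have x: "x \<in> ?S" "f x = x" "radial_D f x = id" using that by (auto simp: E_def)
    have nz: "x \<noteq> 0" using x by auto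
    define \<Phi> where "\<Phi> y = (\<Sum>i<n. F i y)" for y
    define \<Phi>' where "\<Phi>' y h = (\<Sum>i<n. radial_D (f ^^ i) y h)" for y h
    obtain r where r: "r > 0" "inj_on \<Phi> (ball x r)"
    proof (rule locally_injective_if_inj_derivative[of "- {0}" x \<Phi> \<Phi>'])
      show "(\<Phi> has_derivative \<Phi>' y) (at y)" if "y \<in> - {0}" for y
        unfolding \<Phi>_def[abs_def] \<Phi>'_def[abs_def] F_def
        using that by (intro has_derivative_sum has_derivative_radial_ext fi) auto
      show "continuous_on (- {0}) (\<lambda>y. \<Phi>' y h)" for h
        unfolding \<Phi>'_def by (intro continuous_on_sum continuous_on_radial_D fi)
      have "\<Phi>' x = (\<lambda>h. real n *\<^sub>R h)"
        by (simp add: \<Phi>'_def[abs_def] radial_D_funpow[OF f x(1,2)] x(3) sum_constant_scaleR)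
      then show "inj (\<Phi>' x)" using n(1) by (simp add: inj_def)
    qed (use nz in auto)
    have inv: "\<Phi> (radial_ext f y) = \<Phi> y" for y
    proof -
      have "\<Phi> (radial_ext f y) = (\<Sum>i<n. F (Suc i) y)" by (simp add: \<Phi>_def FF)
      also have "\<dots> = (\<Sum>i<n. F i y) + F n y - F 0 y"
        using sum.lessThan_Suc_shift[of "\<lambda>i. F i y" n] sum.lessThan_Suc[of "\<lambda>i. F i y" n]
        by (simp add: algebra_simps)
      finally show ?thesis by (simp add: \<Phi>_def Fn)
    qed
    have "radial_ext f x = x" using x by (simp add: radial_ext_sphere)
    then obtain s where s: "s > 0" "\<And>y. dist y x < s \<Longrightarrow> radial_ext f y \<in> ball x r"
      using cont[OF nz] r(1) unfolding continuous_at_eps_delta by (metis dist_commute mem_ball)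
    define t where "t = min (min r s) 1"
    have "radial_ext f y = y \<and> y \<noteq> 0" if "y \<in> ball x t" for y
    proof
      show "radial_ext f y = y"
        using r(2) inv[of y] s(2)[of y] that by (auto simp: inj_on_def t_def dist_commute)
      show "y \<noteq> 0" using that x(1) by (auto simp: t_def)
    qed
    moreover have "t > 0" using r s by (simp add: t_def)
    ultimately show ?thesis by blast
  qed
  note nbhd = this
  have "openin (top_of_set ?S) E"
    unfolding openin_contains_ball
  proof (intro conjI ballI)
    show "E \<subseteq> ?S" by (auto simp: E_def)
    fix x assume "x \<in> E"
    then obtain r where r: "r > 0" "\<And>y. y \<in> ball x r \<Longrightarrow> radial_ext f y = y" using nbhd by blast
    have "y \<in> E" if y: "y \<in> ball x r" "y \<in> ?S" for y
    proof -
      have "(radial_ext f has_derivative id) (at y)"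
        by (rule has_derivative_transform_within_open[OF has_derivative_id open_ball y(1)])
          (simp add: r)
      then have "radial_D f y = id" using frechet_derivative_at by metis
      then show ?thesis using y r(2)[OF y(1)] by (simp add: E_def radial_ext_sphere)
    qed
    then show "\<exists>e>0. ball x e \<inter> ?S \<subseteq> E" using r(1) by blast
  qed
  moreover have "closedin (top_of_set ?S) E"
  proof -
    have c: "continuous_on ?S (\<lambda>x. radial_D f x h)" for h
      using continuous_on_radial_D[OF f(1)] by (rule continuous_on_subset) auto
    have c0: "continuous_on ?S (radial_ext f)"
      by (intro continuous_at_imp_continuous_on ballI cont) auto
    have "closedin (top_of_set ?S) {x \<in> ?S. radial_ext f x - x = 0}"
      "closedin (top_of_set ?S) {x \<in> ?S. radial_D f x h - h = 0}" for h
      by (intro continuous_closedin_preimage_constant continuous_intros c c0)+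
    then have "closedin (top_of_set ?S) ({x \<in> ?S. radial_ext f x - x = 0} \<inter>
        (\<Inter>h. {x \<in> ?S. radial_D f x h - h = 0}))"
      by (intro closedin_Int closedin_INT) auto
    also have "\<dots> = E" by (auto simp: E_def radial_ext_sphere fun_eq_iff)
    finally show ?thesis .
  qed
  moreover have "connected ?S" using connected_sphere[OF dim] .
  ultimately have "E = {} \<or> E = ?S" using connected_clopen by blast
  moreover have "p \<in> E" using p by (simp add: E_def)
  ultimately have "x \<in> E" using x by blast
  then show ?thesis by (simp add: E_def)
qed

lemma C1_map_on_imp_continuous_on_sphere:
  fixes f :: "'a::euclidean_space \<Rightarrow> 'b::euclidean_space"
  assumes "C1_map_on (sphere 0 1) f"
  shows "continuous_on (sphere 0 1) f"
proof -
  have "continuous_on (sphere 0 1) (radial_ext f)"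
  proof (intro continuous_at_imp_continuous_on ballI)
    fix x :: 'a assume "x \<in> sphere 0 1"
    then have "x \<noteq> 0" by auto
    then show "isCont (radial_ext f) x"
      by (rule has_derivative_continuous[OF has_derivative_radial_ext[OF assms]])
  qed
  then show ?thesis by (rule continuous_on_eq) (rule radial_ext_sphere)
qed

lemma radial_D_cong_id:
  assumes "\<And>x. x \<in> sphere 0 1 \<Longrightarrow> f x = x"
  shows "radial_D f x = id"
proof -
  have "radial_ext f = radial_ext (\<lambda>x. x)" using assms by (rule radial_ext_cong)
  then show ?thesis
    using frechet_derivative_at[OF has_derivative_id, of x] by (simp add: radial_ext_ident id_def)
qed

text \<open>
  Let \<open>F\<close> be the radial extension and \<open>A\<close> its derivative at the fixed point \<open>p\<close>. As \<open>f\<close> is not the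
  identity, neither is \<open>A\<close>, and the fixed vectors of \<open>A\<close> are the multiples of \<open>p\<close>. The map \<open>\<psi> y =
  F y - y + (\<bar>y\<bar>\<^sup>2 / 2) p\<close> takes the value \<open>p / 2\<close> at every fixed point on the sphere, while its
  derivative \<open>A - 1 + p p\<^sup>t\<close> at \<open>p\<close> is injective: the added quadratic term repairs exactly the
  kernel of \<open>A - 1\<close>. So \<open>\<psi>\<close> is injective near \<open>p\<close>, and no other fixed point is close.
\<close>

lemma isolated_fixed_point:
  fixes f :: "real^3 \<Rightarrow> real^3"
  assumes f: "C1_map_on S2 f" "f ` S2 \<subseteq> S2"
    and n: "n > 0" "\<And>x. x \<in> S2 \<Longrightarrow> (f ^^ n) x = x"
    and p: "p \<in> S2" "f p = p" and det: "det (matrix (radial_D f p)) > 0"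
    and nontrivial: "\<exists>x\<in>S2. f x \<noteq> x"
  obtains r where "r > 0" "\<And>x. x \<in> S2 \<Longrightarrow> x \<in> ball p r \<Longrightarrow> f x = x \<Longrightarrow> x = p"
proof -
  define A where "A = radial_D f p"
  have nz: "p \<noteq> 0" and np: "norm p = 1" using p by auto
  have lin: "linear A" unfolding A_def by (rule linear_radial_D[OF f(1) nz])
  have Ap: "A p = p" using radial_D_radial[OF f(1) p(1)] p(2) by (simp add: A_def)
  have tangent: "p \<bullet> A h = p \<bullet> h" for h
    using inner_radial_D[OF f p(1)] p(2) by (simp add: A_def)
  have "radial_D (f ^^ n) p = id" using n(2) by (rule radial_D_cong_id)
  then have "A ^^ n = id" using radial_D_funpow[OF f p, of n] by (simp only: A_def)
  then have An: "(A ^^ n) h = h" for h by simp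
  have A: "\<not> (\<forall>h. A h = h)"
  proof
    assume "\<forall>h. A h = h"
    then have "radial_D f p = id" by (simp add: A_def fun_eq_iff)
    from eq_ident_if_radial_D_eq_id[OF _ f n p this] have "f x = x" if "x \<in> S2" for x
      using that by simp
    then show False using nontrivial by blast
  qed
  define \<psi> where "\<psi> y = radial_ext f y - y + ((y \<bullet> y) / 2) *\<^sub>R p" for y
  define \<psi>' where "\<psi>' y h = radial_D f y h - h + (y \<bullet> h) *\<^sub>R p" for y h
  obtain r where r: "r > 0" "inj_on \<psi> (ball p r)"
  proof (rule locally_injective_if_inj_derivative[of "- {0}" p \<psi> \<psi>'])
    show "(\<psi> has_derivative \<psi>' y) (at y)" if "y \<in> - {0}" for y
    proof -
      have nz: "y \<noteq> 0" using that by simp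
      have quad: "((\<lambda>y. (y \<bullet> y) / 2) has_derivative (\<lambda>h. y \<bullet> h)) (at y)"
        by (auto intro!: derivative_eq_intros simp: inner_commute)
      show ?thesis
        unfolding \<psi>_def[abs_def] \<psi>'_def[abs_def]
        by (rule has_derivative_add[OF has_derivative_diff[OF has_derivative_radial_ext[OF f(1) nz]
              has_derivative_ident] has_derivative_scaleR_left[OF quad]])
    qed
    show "continuous_on (- {0}) (\<lambda>y. \<psi>' y h)" for h
      unfolding \<psi>'_def by (intro continuous_intros continuous_on_radial_D f)
    have lin': "linear (\<psi>' p)"
      using lin by (auto intro!: linearI simp: \<psi>'_def linear_add linear_scale inner_simps algebra_simps simp flip: A_def)
    show "inj (\<psi>' p)"
      unfolding linear_injective_0[OF lin']
    proof (intro allI impI)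
      fix h assume h: "\<psi>' p h = 0"
      have "p \<bullet> \<psi>' p h = p \<bullet> h"
        using tangent[of h] np by (simp add: \<psi>'_def inner_simps norm_eq_1 flip: A_def)
      then have "p \<bullet> h = 0" using h by simp
      then have "A h = h" using h by (simp add: \<psi>'_def flip: A_def)
      show "h = 0"
      proof (rule ccontr)
        assume "h \<noteq> 0"
        then have "h \<noteq> (p \<bullet> h) *\<^sub>R p" using \<open>p \<bullet> h = 0\<close> by simp
        from eq_id_if_fixes_plane[OF lin np Ap tangent _ n(1) An \<open>A h = h\<close> this] det A
        show False by (simp add: A_def)
      qed
    qed
  qed (use nz in auto)
  show ?thesis
  proof (rule that[OF r(1)])
    fix x assume x: "x \<in> S2" "x \<in> ball p r" "f x = x"
    have "\<psi> y = (1 / 2) *\<^sub>R p" if "y \<in> S2" "f y = y" for y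
      using that by (simp add: \<psi>_def radial_ext_sphere dot_square_norm)
    then have "\<psi> x = \<psi> p" using x p by simp
    then show "x = p" using r x by (auto simp: inj_on_def)
  qed
qed

lemma finite_fixed_points:
  fixes f :: "real^3 \<Rightarrow> real^3"
  assumes f: "C1_map_on S2 f" "f ` S2 \<subseteq> S2"
    and n: "n > 0" "\<And>x. x \<in> S2 \<Longrightarrow> (f ^^ n) x = x"
    and det: "\<And>p. p \<in> S2 \<Longrightarrow> det (matrix (radial_D f p)) > 0"
    and nontrivial: "\<exists>x\<in>S2. f x \<noteq> x"
  shows "finite {x \<in> S2. f x = x}"
proof (rule ccontr)
  define E where "E = {x \<in> S2. f x = x}"
  assume "infinite {x \<in> S2. f x = x}"
  then have inf: "infinite E" by (simp add: E_def)
  have "closedin (top_of_set S2) {x \<in> S2. f x - x = 0}"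
    using C1_map_on_imp_continuous_on_sphere[OF f(1)]
    by (intro continuous_closedin_preimage_constant continuous_intros)
  then have "compact E"
    unfolding E_def by (simp add: closedin_compact_eq)
  then obtain p where p: "p \<in> E" "p islimpt E"
    using inf unfolding compact_eq_Bolzano_Weierstrass by blast
  then obtain r where r: "r > 0" "\<And>x. x \<in> S2 \<Longrightarrow> x \<in> ball p r \<Longrightarrow> f x = x \<Longrightarrow> x = p"
    using isolated_fixed_point[OF f n _ _ det nontrivial, of p] by (auto simp: E_def)
  obtain y where "y \<in> E" "y \<noteq> p" "dist y p < r" using p(2) r(1) unfolding islimpt_approachable by blast
  then show False using r(2)[of y] by (auto simp: E_def dist_commute)
qed

section \<open>Orientation\<close>

text \<open>
  The base point of the determinant is immaterial for a diffeomorphism, because the sign of the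
  Jacobian determinant is locally constant where it does not vanish.
\<close>

definition orientation_S2 :: "(real^3 \<Rightarrow> real^3) \<Rightarrow> real" where
  "orientation_S2 f = sgn (det (matrix (radial_D f (axis 1 1))))"

lemma axis_in_S2: "axis 1 1 \<in> S2" by (simp add: norm_axis_1)

lemma sgn_det_radial_D:
  assumes f: "C1_map_on S2 f" and x: "x \<in> S2"
    and regular: "\<And>x. x \<in> S2 \<Longrightarrow> det (matrix (radial_D f x)) \<noteq> 0"
  shows "sgn (det (matrix (radial_D f x))) = orientation_S2 f"
proof -
  let ?J = "\<lambda>x. det (matrix (radial_D f x))"
  have "continuous_on S2 (\<lambda>x. radial_D f x h)" for h
    using continuous_on_radial_D[OF f] by (rule continuous_on_subset) auto
  then have "continuous_on S2 ?J"
    unfolding det_3 matrix_def by (simp) (intro continuous_intros)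
  then have "continuous_on S2 (\<lambda>x. sgn (?J x))" using regular by (intro continuous_on_sgn) auto
  moreover have "finite ((\<lambda>x. sgn (?J x)) ` S2)"
    by (rule finite_subset[of _ "{-1, 0, 1}"]) (auto simp: sgn_if)
  moreover have "connected S2" by (rule connected_sphere) simp
  ultimately have "(\<lambda>x. sgn (?J x)) constant_on S2" by (intro continuous_finite_range_constant)
  then obtain c where "\<And>y. y \<in> S2 \<Longrightarrow> sgn (?J y) = c" unfolding constant_on_def by blast
  then show ?thesis unfolding orientation_S2_def using x axis_in_S2 by simp
qed

lemma det_radial_D_compose:
  fixes f g :: "real^3 \<Rightarrow> real^3"
  assumes f: "C1_map_on S2 f" and g: "C1_map_on S2 g" "g ` S2 \<subseteq> S2" and x: "x \<in> S2"
  shows "det (matrix (radial_D (\<lambda>x. f (g x)) x)) = det (matrix (radial_D f (g x))) * det (matrix (radial_D g x))"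
proof -
  have "g x \<in> S2" using g x by blast
  then have nz: "x \<noteq> 0" "g x \<noteq> 0" using x by auto
  show ?thesis
    unfolding radial_D_compose[OF f g x]
    by (simp add: matrix_compose linear_radial_D[OF f nz(2)] linear_radial_D[OF g(1) nz(1)] det_mul)
qed

lemma det_radial_D_nonzero:
  fixes f g :: "real^3 \<Rightarrow> real^3"
  assumes f: "C1_map_on S2 f" "f ` S2 \<subseteq> S2" and g: "C1_map_on S2 g" and gf: "\<And>x. x \<in> S2 \<Longrightarrow> g (f x) = x"
    and x: "x \<in> S2"
  shows "det (matrix (radial_D f x)) \<noteq> 0"
proof -
  have "radial_D (\<lambda>x. g (f x)) x = id" using gf by (rule radial_D_cong_id)
  then show ?thesis using det_radial_D_compose[OF g f x] by auto
qed

section \<open>The Brouwer degree on the sphere in space\<close>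

text \<open>
  The degree is defined on spheres of real sequences; \<open>coords3\<close> and \<open>of_coords3\<close> identify these
  with vectors of the space.
\<close>

definition coords3 :: "real^3 \<Rightarrow> nat \<Rightarrow> real" where
  "coords3 x = (\<lambda>i. if i = 0 then x $ 1 else if i = 1 then x $ 2 else if i = 2 then x $ 3 else 0)"

definition of_coords3 :: "(nat \<Rightarrow> real) \<Rightarrow> real^3" where
  "of_coords3 y = vector [y 0, y 1, y 2]"

definition degree_S2 :: "(real^3 \<Rightarrow> real^3) \<Rightarrow> int" where
  "degree_S2 f = Brouwer_degree2 2 (coords3 \<circ> f \<circ> of_coords3)"

lemma of_coords3_coords3 [simp]: "of_coords3 (coords3 x) = x"
  by (simp add: of_coords3_def coords3_def vec_eq_iff forall_3)

lemma norm_real3: "norm (x :: real^3) = sqrt ((x $ 1)\<^sup>2 + (x $ 2)\<^sup>2 + (x $ 3)\<^sup>2)"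
  by (simp add: norm_vec_def L2_set_def sum_3)

lemma topspace_nsphere2: "topspace (nsphere 2) = {y. (y 0)\<^sup>2 + (y 1)\<^sup>2 + (y 2)\<^sup>2 = 1 \<and> (\<forall>i>2. y i = 0)}"
  by (auto simp: nsphere numeral_2_eq_2)

lemma coords3_of_coords3: "y \<in> topspace (nsphere 2) \<Longrightarrow> coords3 (of_coords3 y) = y"
  by (auto simp: topspace_nsphere2 of_coords3_def coords3_def fun_eq_iff)

lemma continuous_coords3: "continuous_map (top_of_set S2) (nsphere 2) coords3"
proof -
  have "continuous_map (top_of_set S2) euclideanreal (\<lambda>x. coords3 x i)" for i
  proof -
    consider "i = 0" | "i = 1" | "i = 2" | "i > 2" by linarith
    then show ?thesis
      by cases (auto simp: coords3_def intro!: continuous_intros)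
  qed
  then show ?thesis
    by (auto simp: nsphere continuous_map_in_subtopology continuous_map_componentwise_UNIV
        coords3_def norm_real3 numeral_2_eq_2)
qed

lemma continuous_of_coords3: "continuous_map (nsphere 2) (top_of_set S2) of_coords3"
proof -
  have "continuous_map (nsphere 2) euclidean of_coords3"
    unfolding continuous_map_atin
  proof
    fix y assume "y \<in> topspace (nsphere 2)"
    then have lim: "((\<lambda>z. z i) \<longlongrightarrow> y i) (atin (nsphere 2) y)" for i
      using continuous_map_nsphere_projection[of 2 i] by (simp add: continuous_map_atin)
    have "((\<lambda>z. of_coords3 z $ i) \<longlongrightarrow> of_coords3 y $ i) (atin (nsphere 2) y)" for i
      using exhaust_3[of i] lim by (auto simp: of_coords3_def)
    then show "limitin euclidean of_coords3 (of_coords3 y) (atin (nsphere 2) y)"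
      by (simp add: vec_tendstoI)
  qed
  then show ?thesis
    by (auto simp: continuous_map_in_subtopology topspace_nsphere2 of_coords3_def norm_real3)
qed

lemma continuous_conj_coords3:
  assumes "continuous_on S2 f" "f ` S2 \<subseteq> S2"
  shows "continuous_map (nsphere 2) (nsphere 2) (coords3 \<circ> f \<circ> of_coords3)"
proof -
  have "continuous_map (top_of_set S2) (top_of_set S2) f" using assms by (auto simp: image_subset_iff)
  then show ?thesis
    using continuous_map_compose continuous_of_coords3 continuous_coords3 by (metis comp_assoc)
qed

lemma degree_S2_cong:
  assumes "\<And>x. x \<in> S2 \<Longrightarrow> f x = g x"
  shows "degree_S2 f = degree_S2 g"
  unfolding degree_S2_def
proof (rule Brouwer_degree2_eq)
  fix y assume "y \<in> topspace (nsphere 2)"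
  then have "of_coords3 y \<in> S2" using continuous_of_coords3 by (auto simp: continuous_map_def)
  then show "(coords3 \<circ> f \<circ> of_coords3) y = (coords3 \<circ> g \<circ> of_coords3) y" using assms by simp
qed

lemma degree_S2_ident: "degree_S2 (\<lambda>x. x) = 1"
proof -
  have "degree_S2 (\<lambda>x. x) = Brouwer_degree2 2 id"
    unfolding degree_S2_def by (rule Brouwer_degree2_eq) (simp add: coords3_of_coords3)
  then show ?thesis by simp
qed

lemma degree_S2_compose:
  assumes f: "continuous_on S2 f" "f ` S2 \<subseteq> S2" and g: "continuous_on S2 g" "g ` S2 \<subseteq> S2"
  shows "degree_S2 (\<lambda>x. f (g x)) = degree_S2 f * degree_S2 g"
proof -
  have "coords3 \<circ> (\<lambda>x. f (g x)) \<circ> of_coords3 = (coords3 \<circ> f \<circ> of_coords3) \<circ> (coords3 \<circ> g \<circ> of_coords3)"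
    by (simp add: fun_eq_iff)
  then show ?thesis
    unfolding degree_S2_def
    using Brouwer_degree2_compose[OF continuous_conj_coords3[OF g] continuous_conj_coords3[OF f]] by simp
qed

text \<open>
  The segment from \<open>f x\<close> to \<open>g x\<close> avoids the origin when these points are not antipodal, so the
  straight-line homotopy can be projected radially onto the sphere.
\<close>

lemma degree_S2_eq_if_not_antipodal:
  assumes f: "continuous_on S2 f" "f ` S2 \<subseteq> S2" and g: "continuous_on S2 g" "g ` S2 \<subseteq> S2"
    and ne: "\<And>x. x \<in> S2 \<Longrightarrow> f x \<noteq> - g x"
  shows "degree_S2 f = degree_S2 g"
proof -
  have "homotopic_with_canon (\<lambda>_. True) S2 (- {0}) f g"
  proof (rule homotopic_with_linear[OF f(1) g(1)])
    fix x assume x: "x \<in> S2"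
    then have n: "norm (f x) = 1" "norm (g x) = 1" using f g by (auto simp: image_subset_iff)
    have "0 \<notin> closed_segment (f x) (g x)"
    proof
      assume "0 \<in> closed_segment (f x) (g x)"
      then obtain u where u: "0 \<le> u" "u \<le> 1" "(1 - u) *\<^sub>R f x + u *\<^sub>R g x = 0"
        by (auto simp: closed_segment_def)
      then have eq: "(1 - u) *\<^sub>R f x = - (u *\<^sub>R g x)" by (simp add: add_eq_0_iff)
      have "norm ((1 - u) *\<^sub>R f x) = norm (- (u *\<^sub>R g x))" using eq by (rule arg_cong)
      then have half: "1 - u = u" using n u by simp
      then have "u *\<^sub>R f x = u *\<^sub>R (- g x)" using eq unfolding half by simp
      moreover have "u \<noteq> 0" using half by auto
      ultimately have "f x = - g x" using scaleR_cancel_left by blast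
      then show False using ne[OF x] by simp
    qed
    then show "closed_segment (f x) (g x) \<subseteq> - {0}" by auto
  qed
  then have "homotopic_with_canon (\<lambda>_. True) S2 S2 (sgn \<circ> f) (sgn \<circ> g)"
    by (rule homotopic_with_compose_continuous_left)
       (auto intro!: continuous_intros simp: norm_sgn)
  then have "homotopic_with_canon (\<lambda>_. True) S2 S2 f g"
    by (rule homotopic_with_eq) (use f g in \<open>auto simp: image_subset_iff sgn_div_norm\<close>)
  then have "homotopic_with (\<lambda>_. True) (nsphere 2) (top_of_set S2) (f \<circ> of_coords3) (g \<circ> of_coords3)"
    using continuous_of_coords3 by (rule homotopic_with_compose_continuous_map_right) auto
  then have "homotopic_with (\<lambda>_. True) (nsphere 2) (nsphere 2) (coords3 \<circ> (f \<circ> of_coords3)) (coords3 \<circ> (g \<circ> of_coords3))"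
    using continuous_coords3 by (rule homotopic_with_compose_continuous_map_left) auto
  then show ?thesis unfolding degree_S2_def by (simp add: Brouwer_degree2_homotopic comp_assoc)
qed

text \<open>
  The antipodal map is the reflection \<open>r\<close> in a coordinate plane followed by a half-turn in that
  plane. The half-turn is the square of the quarter-turn \<open>q\<close>, and \<open>q\<close> sends no point to its
  antipode, so it has degree 1; the reflection has degree \<open>-1\<close>.
\<close>

lemma degree_S2_antipodal: "degree_S2 uminus = -1"
proof -
  define r :: "real^3 \<Rightarrow> real^3" where "r x = vector [- x $ 1, x $ 2, x $ 3]" for x
  define q :: "real^3 \<Rightarrow> real^3" where "q x = vector [x $ 1, - x $ 3, x $ 2]" for x
  have lin: "linear r" "linear q"
    by (auto intro!: linearI simp: r_def q_def vec_eq_iff forall_3)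
  then have cont: "continuous_on S2 r" "continuous_on S2 q"
    by (simp_all add: linear_continuous_on linear_conv_bounded_linear)
  have r: "continuous_on S2 r" "r ` S2 \<subseteq> S2" and q: "continuous_on S2 q" "q ` S2 \<subseteq> S2"
    using cont by (auto simp: norm_real3 r_def q_def add_ac)
  have i: "continuous_on S2 (\<lambda>x. x)" "(\<lambda>x. x) ` S2 \<subseteq> S2" by auto
  have "degree_S2 q = degree_S2 (\<lambda>x. x)"
  proof (rule degree_S2_eq_if_not_antipodal[OF q i])
    fix x :: "real^3" assume "x \<in> S2"
    show "q x \<noteq> - x"
    proof
      assume "q x = - x"
      then have eq: "q x $ i = - (x $ i)" for i by simp
      have "x $ 1 = - (x $ 1)" using eq[of 1] by (simp add: q_def)
      moreover have "- (x $ 3) = - (x $ 2)" using eq[of 2] by (simp add: q_def)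
      moreover have "x $ 2 = - (x $ 3)" using eq[of 3] by (simp add: q_def)
      ultimately have "x $ 1 = 0" "x $ 2 = 0" "x $ 3 = 0" by linarith+
      then have "x = 0" by (simp add: vec_eq_iff forall_3)
      with \<open>x \<in> S2\<close> show False by simp
    qed
  qed
  then have "degree_S2 (\<lambda>x. q (q x)) = 1" using degree_S2_compose[OF q q] by (simp only: degree_S2_ident mult_1)
  moreover have "continuous_on S2 (\<lambda>x. q (q x))" "(\<lambda>x. q (q x)) ` S2 \<subseteq> S2"
    using continuous_on_compose2[OF q(1) q(1) q(2)] q(2) by blast+
  ultimately have "degree_S2 (\<lambda>x. r (q (q x))) = degree_S2 r" using degree_S2_compose[OF r, of "\<lambda>x. q (q x)"] by (simp only: mult_1_right)
  moreover have "(\<lambda>x. r (q (q x))) = uminus"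
    by (rule ext) (simp add: r_def q_def vec_eq_iff forall_3)
  moreover have "degree_S2 r = Brouwer_degree2 2 (\<lambda>x i. if i = 0 then -x i else x i)"
    unfolding degree_S2_def
  proof (rule Brouwer_degree2_eq, rule ext)
    fix y and i :: nat assume "y \<in> topspace (nsphere 2)"
    then have y: "y j = 0" if "j > 2" for j using that by (simp add: topspace_nsphere2)
    consider "i = 0" | "i = 1" | "i = 2" | "i > 2" by linarith
    then show "(coords3 \<circ> r \<circ> of_coords3) y i = (if i = 0 then - y i else y i)"
      by cases (simp_all add: r_def coords3_def of_coords3_def y)
  qed
  ultimately show ?thesis using Brouwer_degree2_reflection[of 2] by simp
qed

text \<open>
  A map without fixed points is never antipodal to the antipodal map, and so has its degree \<open>-1\<close>.
\<close>

lemma fixed_point_if_degree_S2: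
  assumes f: "continuous_on S2 f" "f ` S2 \<subseteq> S2" and deg: "degree_S2 f \<noteq> -1"
  obtains x where "x \<in> S2" "f x = x"
proof -
  have "continuous_on S2 uminus" "uminus ` S2 \<subseteq> (S2 :: (real^3) set)"
    by (auto intro!: continuous_intros)
  then have "\<exists>x\<in>S2. f x = - (- x)"
    using degree_S2_eq_if_not_antipodal[OF f] deg degree_S2_antipodal by metis
  then show ?thesis using that by auto
qed

section \<open>Two-groups of diffeomorphisms of the sphere\<close>

lemma in_C1_diffeos:
  assumes "f \<in> C1_diffeos S"
  shows "C1_map_on S f" "f ` S = S" "f \<in> extensional S"
  using assms by (auto simp: C1_diffeos_def Bij_def bij_betw_def)

lemma det_radial_D_diffeo:
  assumes f: "f \<in> C1_diffeos S2"
  shows "x \<in> S2 \<Longrightarrow> det (matrix (radial_D f x)) \<noteq> 0"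
    and "x \<in> S2 \<Longrightarrow> sgn (det (matrix (radial_D f x))) = orientation_S2 f"
    and "orientation_S2 f \<in> {-1, 1}"
proof -
  have g: "C1_map_on S2 (inv_into S2 f)" "\<And>x. x \<in> S2 \<Longrightarrow> inv_into S2 f (f x) = x"
    using f by (auto simp: C1_diffeos_def Bij_def bij_betw_def)
  show nz: "x \<in> S2 \<Longrightarrow> det (matrix (radial_D f x)) \<noteq> 0" for x
    using det_radial_D_nonzero[OF _ _ g] in_C1_diffeos[OF f] by simp
  show sg: "x \<in> S2 \<Longrightarrow> sgn (det (matrix (radial_D f x))) = orientation_S2 f" for x
    using sgn_det_radial_D[OF _ _ nz] in_C1_diffeos[OF f] by simp
  show "orientation_S2 f \<in> {-1, 1}"
    unfolding orientation_S2_def using nz[OF axis_in_S2] by (auto simp: sgn_if)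
qed

lemma orientation_S2_compose:
  assumes f: "f \<in> C1_diffeos S2" and g: "g \<in> C1_diffeos S2"
  shows "orientation_S2 (compose S2 f g) = orientation_S2 f * orientation_S2 g"
proof -
  let ?e = "axis 1 1 :: real^3"
  have "radial_ext (compose S2 f g) = radial_ext (\<lambda>x. f (g x))"
    by (rule radial_ext_cong) (simp add: compose_eq)
  then have "orientation_S2 (compose S2 f g) = sgn (det (matrix (radial_D (\<lambda>x. f (g x)) ?e)))"
    by (simp add: orientation_S2_def)
  also have "\<dots> = sgn (det (matrix (radial_D f (g ?e)))) * sgn (det (matrix (radial_D g ?e)))"
    using det_radial_D_compose[OF _ _ _ axis_in_S2, of f g] in_C1_diffeos[OF f] in_C1_diffeos[OF g]
    by (simp add: sgn_mult)
  also have "\<dots> = orientation_S2 f * orientation_S2 g"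
  proof -
    have "g ?e \<in> S2" using in_C1_diffeos(2)[OF g] axis_in_S2 by blast
    then show ?thesis
      by (simp only: det_radial_D_diffeo(2)[OF f] det_radial_D_diffeo(2)[OF g axis_in_S2])
  qed
  finally show ?thesis .
qed

lemma degree_S2_compose_diffeo:
  assumes f: "f \<in> C1_diffeos S2" and g: "g \<in> C1_diffeos S2"
  shows "degree_S2 (compose S2 f g) = degree_S2 f * degree_S2 g"
proof -
  have "degree_S2 (compose S2 f g) = degree_S2 (\<lambda>x. f (g x))"
    by (rule degree_S2_cong) (simp add: compose_eq)
  then show ?thesis
    using degree_S2_compose[of f g] in_C1_diffeos(2)[OF f] in_C1_diffeos(2)[OF g]
      C1_map_on_imp_continuous_on_sphere[OF in_C1_diffeos(1)[OF f]]
      C1_map_on_imp_continuous_on_sphere[OF in_C1_diffeos(1)[OF g]] by simp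
qed

lemma mult_Diff1: "f \<in> C1_diffeos S \<Longrightarrow> g \<in> C1_diffeos S \<Longrightarrow> f \<otimes>\<^bsub>Diff1 S\<^esub> g = compose S f g"
  by (simp add: Diff1_def BijGroup_def C1_diffeos_def)

lemma one_Diff1: "\<one>\<^bsub>Diff1 S\<^esub> = (\<lambda>x\<in>S. x)"
  by (simp add: Diff1_def BijGroup_def)

lemma carrier_Diff1: "carrier (Diff1 S) = C1_diffeos S"
  by (simp add: Diff1_def)

lemma pow_Diff1_apply:
  assumes "subgroup H (Diff1 S)" "g \<in> H" "x \<in> S"
  shows "(g [^]\<^bsub>(Diff1 S)\<lparr>carrier := H\<rparr>\<^esub> (n::nat)) x = (g ^^ n) x"
proof -
  let ?H = "(Diff1 S)\<lparr>carrier := H\<rparr>"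
  interpret H: group ?H by (rule group.subgroup_imp_group[OF group_Diff1 assms(1)])
  have sub: "H \<subseteq> C1_diffeos S" using subgroup.subset[OF assms(1)] by (simp add: carrier_Diff1)
  show ?thesis using assms(3)
  proof (induction n arbitrary: x)
    case 0
    then show ?case by (simp add: one_Diff1)
  next
    case (Suc n)
    have g: "g \<in> C1_diffeos S" using sub assms(2) by blast
    have "g [^]\<^bsub>?H\<^esub> n \<in> H" using H.nat_pow_closed[of g n] assms(2) by simp
    then have gn: "g [^]\<^bsub>?H\<^esub> n \<in> C1_diffeos S" using sub by blast
    have "g [^]\<^bsub>?H\<^esub> Suc n = g [^]\<^bsub>?H\<^esub> n \<otimes>\<^bsub>Diff1 S\<^esub> g" by simp
    then have "g [^]\<^bsub>?H\<^esub> Suc n = compose S (g [^]\<^bsub>?H\<^esub> n) g"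
      using mult_Diff1[OF gn g] by simp
    moreover have "g x \<in> S" using in_C1_diffeos(2)[OF g] Suc.prems by blast
    ultimately show ?case using Suc.IH[of "g x"] Suc.prems by (simp add: compose_eq funpow_swap1)
  qed
qed

text \<open>
  A non-identity element has finitely many fixed points, and at least one since its degree is 1.
  At a fixed point \<open>p\<close> the derivative represents the stabilizer of \<open>p\<close> faithfully. An involution
  there acts as \<open>-1\<close> on tangent vectors, because \<open>h + A h\<close> is fixed by its derivative \<open>A\<close>; so two
  involutions fixing \<open>p\<close> have the same derivative and coincide. A quaternion pair would yield
  anticommuting maps of the tangent plane with square \<open>-1\<close>.
\<close>

theorem finite_orientation_preserving_2_group:
  assumes K: "subgroup K (Diff1 S2)"
    and k: "\<And>g x. g \<in> K \<Longrightarrow> x \<in> S2 \<Longrightarrow> (g ^^ (2 ^ k)) x = x"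
    and orientation: "\<And>g. g \<in> K \<Longrightarrow> orientation_S2 g = 1"
    and degree: "\<And>g. g \<in> K \<Longrightarrow> degree_S2 g = 1"
  shows "finite K"
proof -
  define M where "M = (Diff1 S2)\<lparr>carrier := K\<rparr>"
  interpret group M unfolding M_def by (rule group.subgroup_imp_group[OF group_Diff1 K])
  have cM: "carrier M = K" by (simp add: M_def)
  have diffeo: "g \<in> C1_diffeos S2" if "g \<in> K" for g
    using subgroup.subset[OF K] that by (auto simp: carrier_Diff1)
  note diffeoD = in_C1_diffeos[OF diffeo]
  have img: "g ` S2 \<subseteq> S2" if "g \<in> K" for g using diffeoD(2)[OF that] by simp
  have mult: "f \<otimes>\<^bsub>M\<^esub> g = compose S2 f g" if "f \<in> K" "g \<in> K" for f g
    using mult_Diff1[OF diffeo[OF that(1)] diffeo[OF that(2)]] by (simp add: M_def)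
  have one: "\<one>\<^bsub>M\<^esub> = (\<lambda>x\<in>S2. x)" by (simp add: M_def one_Diff1)
  have eq_one: "g = \<one>\<^bsub>M\<^esub>" if "g \<in> K" "\<And>x. x \<in> S2 \<Longrightarrow> g x = x" for g
    using diffeoD(3)[OF that(1)] that(2) unfolding one by (intro extensionalityI[of _ S2]) auto
  have pow: "(g [^]\<^bsub>M\<^esub> (n::nat)) x = (g ^^ n) x" if "g \<in> K" "x \<in> S2" for g n x
    unfolding M_def by (rule pow_Diff1_apply[OF K that])
  have powK: "g [^]\<^bsub>M\<^esub> (n::nat) \<in> K" if "g \<in> K" for g n
    using nat_pow_closed[of g n] that by (simp add: cM)
  have action: "group_action M S2 (\<lambda>g. g)"
  proof -
    have "(\<lambda>g. g) \<in> hom M (BijGroup S2)"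
      by (rule homI) (use diffeo in \<open>auto simp: M_def Diff1_def BijGroup_def C1_diffeos_def\<close>)
    then show ?thesis
      by (intro group_action.intro group_hom.intro group_hom_axioms.intro group_BijGroup is_group)
  qed
  have two_pow: "(2 ^ k :: nat) > 0" by simp
  have det: "det (matrix (radial_D g p)) > 0" if "g \<in> K" "p \<in> S2" for g p
    using det_radial_D_diffeo(2)[OF diffeo[OF that(1)] that(2)] orientation[OF that(1)]
    by (simp add: sgn_1_pos)
  have faithful: "g = \<one>\<^bsub>M\<^esub>" if "g \<in> K" "p \<in> S2" "g p = p" "\<And>h. radial_D g p h = h" for g p
  proof (rule eq_one[OF that(1)])
    have "radial_D g p = id" using that(4) by (simp add: fun_eq_iff)
    from eq_ident_if_radial_D_eq_id[OF _ diffeoD(1)[OF that(1)] img[OF that(1)] two_pow k[OF that(1)] that(2,3) this]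
    show "g x = x" if "x \<in> S2" for x using that by simp
  qed
  have D_mult: "radial_D (f \<otimes>\<^bsub>M\<^esub> g) p h = radial_D f p (radial_D g p h)"
    if "f \<in> K" "g \<in> K" "p \<in> S2" "g p = p" for f g p h
  proof -
    have "radial_ext (f \<otimes>\<^bsub>M\<^esub> g) = radial_ext (\<lambda>x. f (g x))"
      by (rule radial_ext_cong) (simp add: mult that compose_eq)
    then show ?thesis
      using radial_D_compose[OF diffeoD(1)[OF that(1)] diffeoD(1)[OF that(2)] img[OF that(2)] that(3)] that(4)
      by simp
  qed
  have D_radial: "radial_D g p p = p" if "g \<in> K" "p \<in> S2" "g p = p" for g p
    using radial_D_radial[OF diffeoD(1)[OF that(1)] that(2)] that(3) by simp
  have D_tangent: "p \<bullet> radial_D g p h = p \<bullet> h" if "g \<in> K" "p \<in> S2" "g p = p" for g p h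
    using inner_radial_D[OF diffeoD(1)[OF that(1)] img[OF that(1)] that(2)] that(3) by simp
  have D_linear: "linear (radial_D g p)" if "g \<in> K" "p \<in> S2" for g p
    by (rule linear_radial_D[OF diffeoD(1)[OF that(1)]]) (use that(2) in auto)
  have half_turn: "radial_D g p h = - h"
    if g: "g \<in> K" "p \<in> S2" "g p = p" "g \<otimes>\<^bsub>M\<^esub> g = \<one>\<^bsub>M\<^esub>" "g \<noteq> \<one>\<^bsub>M\<^esub>" and h: "p \<bullet> h = 0" for g p h
  proof (rule ccontr)
    assume ne: "radial_D g p h \<noteq> - h"
    let ?A = "radial_D g p"
    have lin: "linear ?A" by (rule D_linear[OF g(1,2)])
    have AA: "?A (?A v) = v" for v
    proof -
      have "radial_D \<one>\<^bsub>M\<^esub> p = id" by (rule radial_D_cong_id) (simp add: one)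
      then show ?thesis using D_mult[OF g(1,1,2,3), of v] g(4) by simp
    qed
    then have AA2: "(?A ^^ 2) v = v" for v by (simp add: numeral_2_eq_2)
    let ?v = "h + ?A h"
    have "p \<bullet> ?v = 0" using h D_tangent[OF g(1-3)] by (simp add: inner_simps)
    moreover have "?v \<noteq> 0" using ne by (metis add.commute add_eq_0_iff)
    ultimately have v: "?v \<noteq> (p \<bullet> ?v) *\<^sub>R p" by simp
    have "?A ?v = ?v" using AA by (simp add: linear_add[OF lin])
    then have "?A u = u" for u
      using eq_id_if_fixes_plane[OF lin _ D_radial[OF g(1-3)] D_tangent[OF g(1-3)] det[OF g(1,2)] _ AA2 _ v] g(2)
      by simp
    then show False using faithful[OF g(1-3)] g(5) by blast
  qed
  have "finite (carrier M)"
  proof (rule group_action.finite_if_finite_fixed_points[OF action, of k])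
    show "g [^]\<^bsub>M\<^esub> (2 ^ k :: nat) = \<one>\<^bsub>M\<^esub>" if "g \<in> carrier M" for g
      using that powK by (intro eq_one) (auto simp: cM pow k)
  next
    fix g assume g: "g \<in> carrier M" "g \<noteq> \<one>\<^bsub>M\<^esub>"
    then have gK: "g \<in> K" by (simp add: cM)
    have nontrivial: "\<exists>x\<in>S2. g x \<noteq> x" using eq_one[OF gK] g(2) by blast
    have "finite {x \<in> S2. g x = x}"
      using finite_fixed_points[OF diffeoD(1)[OF gK] img[OF gK] two_pow k[OF gK] det[OF gK] nontrivial] .
    moreover obtain x where "x \<in> S2" "g x = x"
      using fixed_point_if_degree_S2[OF C1_map_on_imp_continuous_on_sphere[OF diffeoD(1)[OF gK]] img[OF gK]] degree[OF gK]
      by auto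
    ultimately show "finite (invariants S2 (\<lambda>g. g) g) \<and> invariants S2 (\<lambda>g. g) g \<noteq> {}"
      by (auto simp: invariants_def)
  next
    fix p a b
    assume p: "p \<in> S2" and ab: "a \<in> stabilizer M (\<lambda>g. g) p" "b \<in> stabilizer M (\<lambda>g. g) p"
      "a [^]\<^bsub>M\<^esub> (2::nat) = \<one>\<^bsub>M\<^esub>" "b [^]\<^bsub>M\<^esub> (2::nat) = \<one>\<^bsub>M\<^esub>" "a \<noteq> \<one>\<^bsub>M\<^esub>" "b \<noteq> \<one>\<^bsub>M\<^esub>"
    have a: "a \<in> K" "a p = p" and b: "b \<in> K" "b p = p" using ab by (auto simp: stabilizer_def cM)
    have sq: "a \<otimes>\<^bsub>M\<^esub> a = \<one>\<^bsub>M\<^esub>" "b \<otimes>\<^bsub>M\<^esub> b = \<one>\<^bsub>M\<^esub>" using ab a b by (simp_all add: pow2 cM)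
    have D: "radial_D (a \<otimes>\<^bsub>M\<^esub> b) p h = h" for h
    proof -
      \<comment> \<open>The tangential part of \<open>h\<close> is negated twice, and the radial part is fixed.\<close>
      define t where "t = h - (p \<bullet> h) *\<^sub>R p"
      have "p \<bullet> p = 1" using p by (simp add: norm_eq_1)
      then have t: "p \<bullet> t = 0" by (simp add: t_def inner_simps)
      have h: "h = t + (p \<bullet> h) *\<^sub>R p" by (simp add: t_def)
      have "radial_D a p (radial_D b p (t + (p \<bullet> h) *\<^sub>R p)) = t + (p \<bullet> h) *\<^sub>R p"
        using half_turn[OF a(1) p a(2) sq(1) ab(5) t] half_turn[OF b(1) p b(2) sq(2) ab(6) t]
          D_radial[OF a(1) p a(2)] D_radial[OF b(1) p b(2)]
        by (simp add: linear_diff[OF D_linear[OF a(1) p]] linear_scale[OF D_linear[OF a(1) p]]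
            linear_add[OF D_linear[OF b(1) p]] linear_scale[OF D_linear[OF b(1) p]])
      then show ?thesis by (simp only: D_mult[OF a(1) b(1) p b(2)] h[symmetric])
    qed
    have abK: "a \<otimes>\<^bsub>M\<^esub> b \<in> K" using m_closed a b by (simp add: cM)
    have "(a \<otimes>\<^bsub>M\<^esub> b) p = p" using a b p by (simp add: mult compose_eq)
    then have "a \<otimes>\<^bsub>M\<^esub> b = \<one>\<^bsub>M\<^esub>" by (rule faithful[OF abK p _ D])
    then have "a \<otimes>\<^bsub>M\<^esub> b = b \<otimes>\<^bsub>M\<^esub> b" using sq by simp
    then show "a = b" using a b by (simp add: cM)
  next
    fix p a b
    assume p: "p \<in> S2" and ab: "a \<in> stabilizer M (\<lambda>g. g) p" "b \<in> stabilizer M (\<lambda>g. g) p"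
      and rel: "a \<otimes>\<^bsub>M\<^esub> b = inv\<^bsub>M\<^esub> b \<otimes>\<^bsub>M\<^esub> a" "a [^]\<^bsub>M\<^esub> (2::nat) = b [^]\<^bsub>M\<^esub> (2::nat)" "b [^]\<^bsub>M\<^esub> (4::nat) = \<one>\<^bsub>M\<^esub>"
    have a: "a \<in> K" "a p = p" and b: "b \<in> K" "b p = p" using ab by (auto simp: stabilizer_def cM)
    have aM: "a \<in> carrier M" and bM: "b \<in> carrier M" using a b by (auto simp: cM)
    show "b [^]\<^bsub>M\<^esub> (2::nat) = \<one>\<^bsub>M\<^esub>"
    proof (rule ccontr)
      assume ne: "b [^]\<^bsub>M\<^esub> (2::nat) \<noteq> \<one>\<^bsub>M\<^esub>"
      define z where "z = b \<otimes>\<^bsub>M\<^esub> b"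
      have z: "z \<in> K" "z p = p" "z \<noteq> \<one>\<^bsub>M\<^esub>" "a \<otimes>\<^bsub>M\<^esub> a = z"
        using m_closed[OF bM bM] b p ne rel(2) aM bM
        by (auto simp: z_def cM mult compose_eq pow2)
      have "z \<otimes>\<^bsub>M\<^esub> z = b [^]\<^bsub>M\<^esub> (4::nat)"
        using bM by (simp add: z_def numeral_eq_Suc m_assoc)
      then have zz: "z \<otimes>\<^bsub>M\<^esub> z = \<one>\<^bsub>M\<^esub>" using rel(3) by simp
      let ?J = "radial_D a p" and ?Q = "radial_D b p"
      have JJ: "?J (?J h) = - h" and QQ: "?Q (?Q h) = - h" if "p \<bullet> h = 0" for h
        using half_turn[OF z(1) p z(2) zz z(3) that]
          D_mult[OF a(1) a(1) p a(2), of h, unfolded z(4)]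
          D_mult[OF b(1) b(1) p b(2), of h, folded z_def] by simp_all
      \<comment> \<open>The relation \<open>a b = b\<inverse> a\<close> without an inverse, ready for the chain rule.\<close>
      have bab: "b \<otimes>\<^bsub>M\<^esub> (a \<otimes>\<^bsub>M\<^esub> b) = a"
        unfolding rel(1) using aM bM by (simp flip: m_assoc)
      have abK: "a \<otimes>\<^bsub>M\<^esub> b \<in> K" "(a \<otimes>\<^bsub>M\<^esub> b) p = p" using m_closed[OF aM bM] a b p by (auto simp: cM mult compose_eq)
      have QJQ: "?Q (?J (?Q h)) = ?J h" for h
        using D_mult[OF b(1) abK(1) p abK(2), of h]
        unfolding bab D_mult[OF a(1) b(1) p b(2)] by (rule sym)
      have T: "p \<bullet> ?J h = 0" "p \<bullet> ?Q h = 0" if "p \<bullet> h = 0" for h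
        using D_tangent[OF a(1) p a(2), of h] D_tangent[OF b(1) p b(2), of h] that by simp_all
      have anti: "?J (?Q h) = - ?Q (?J h)" if "p \<bullet> h = 0" for h
      proof -
        have "- ?J (?Q h) = ?Q (?Q (?J (?Q h)))" using QQ[OF T(1)[OF T(2)[OF that]]] by (rule sym)
        also have "\<dots> = ?Q (?J h)" by (simp add: QJQ)
        finally show ?thesis by (rule minus_equation_iff[THEN iffD1, THEN sym])
      qed
      have "norm p = 1" using p by simp
      from no_quaternions_on_plane[OF D_linear[OF a(1) p] D_linear[OF b(1) p] this T JJ QQ anti]
      show False .
    qed
  qed
  then show ?thesis by (simp add: cM)
qed

text \<open>
  If \<open>2 ^ a\<close> is the exact power of 2 dividing the order of \<open>x\<close>, then \<open>x ^ (2 ^ a)\<close> has odd order,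
  which only the identity has. Since \<open>2 ^ a \<le> N\<close>, the exponent \<open>2 ^ N\<close> serves all elements at
  once.
\<close>

lemma (in group) pow_two_pow_eq_one:
  assumes x: "x \<in> carrier G" and ord: "0 < ord x" "ord x \<le> N"
    and even: "\<And>y. y \<in> carrier G \<Longrightarrow> y \<noteq> \<one> \<Longrightarrow> even (ord y)"
  shows "x [^] (2 ^ N :: nat) = \<one>"
proof -
  define a where "a = multiplicity 2 (ord x)"
  obtain m where m: "ord x = 2 ^ a * m" "odd m"
    using multiplicity_decompose'[of "ord x" 2] ord(1) by (auto simp: a_def)
  have "x [^] (2 ^ a :: nat) = \<one>"
  proof (rule ccontr)
    assume ne: "x [^] (2 ^ a :: nat) \<noteq> \<one>"
    have "ord (x [^] (2 ^ a :: nat)) = m"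
      using ord_pow_gen[OF x, of "2 ^ a"] m ord(1) by simp
    then show False using even[OF _ ne] x m(2) by simp
  qed
  moreover have "2 ^ a \<le> ord x" using m ord(1) by simp
  then have "a \<le> N" using ord(2) less_exp[of a] by linarith
  then have "(2::nat) ^ N = 2 ^ a * 2 ^ (N - a)" by (simp flip: power_add)
  ultimately show ?thesis using x nat_pow_pow[OF x, of "2 ^ a" "2 ^ (N - a)"] by simp
qed

theorem corollary3:
  fixes G :: "(real^3 \<Rightarrow> real^3) set"
  assumes "subgroup G (Diff1 S2)"
    and "finitely_generated_group ((Diff1 S2)\<lparr>carrier := G\<rparr>)"
    and "periodic_group ((Diff1 S2)\<lparr>carrier := G\<rparr>)"
    and "even_bounded_orders ((Diff1 S2)\<lparr>carrier := G\<rparr>)"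
  shows "finite G"
proof -
  interpret D: group "Diff1 S2" by (rule group_Diff1)
  define M where "M = (Diff1 S2)\<lparr>carrier := G\<rparr>"
  interpret group M unfolding M_def by (rule D.subgroup_imp_group[OF assms(1)])
  interpret S: subgroup G "Diff1 S2" by (rule assms(1))
  have cM: "carrier M = G" by (simp add: M_def)
  have diffeo: "g \<in> C1_diffeos S2" if "g \<in> G" for g
    using S.subset that by (auto simp: carrier_Diff1)
  obtain N where N: "\<And>g. g \<in> G \<Longrightarrow> 0 < ord g \<and> ord g \<le> N" and even: "\<And>g. g \<in> G \<Longrightarrow> g \<noteq> \<one>\<^bsub>M\<^esub> \<Longrightarrow> even (ord g)"
    using assms(4) unfolding even_bounded_orders_def M_def by auto
  have exponent: "(g ^^ (2 ^ N)) x = x" if "g \<in> G" "x \<in> S2" for g x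
  proof -
    have "g [^]\<^bsub>M\<^esub> (2 ^ N :: nat) = \<one>\<^bsub>M\<^esub>"
      using pow_two_pow_eq_one[of g N] N even that by (simp add: cM)
    then show ?thesis
      using pow_Diff1_apply[OF assms(1) that, of "2 ^ N"] that(2) by (simp add: M_def one_Diff1)
  qed
  \<comment> \<open>The two signs form a homomorphism to \<open>{-1, 1} \<times> {-1, 1}\<close>; its kernel \<open>K\<close> has finite index.\<close>
  define \<sigma> where "\<sigma> g = (orientation_S2 g, degree_S2 g)" for g
  define K where "K = {g \<in> G. \<sigma> g = (1, 1)}"
  have mult: "\<sigma> (f \<otimes>\<^bsub>Diff1 S2\<^esub> g) = (fst (\<sigma> f) * fst (\<sigma> g), snd (\<sigma> f) * snd (\<sigma> g))" if "f \<in> G" "g \<in> G" for f g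
    using orientation_S2_compose degree_S2_compose_diffeo diffeo that by (simp add: \<sigma>_def mult_Diff1)
  have "orientation_S2 (\<lambda>x\<in>S2. x) = 1"
    unfolding orientation_S2_def using radial_D_cong_id[of "\<lambda>x\<in>S2. x"] by simp
  moreover have "degree_S2 (\<lambda>x\<in>S2. x) = 1"
    using degree_S2_cong[of "\<lambda>x\<in>S2. x" "\<lambda>x. x"] degree_S2_ident by simp
  ultimately have one: "\<sigma> \<one>\<^bsub>Diff1 S2\<^esub> = (1, 1)" by (simp add: \<sigma>_def one_Diff1)
  have inv: "fst (\<sigma> (inv\<^bsub>Diff1 S2\<^esub> g)) * fst (\<sigma> g) = 1 \<and> snd (\<sigma> (inv\<^bsub>Diff1 S2\<^esub> g)) * snd (\<sigma> g) = 1" if "g \<in> G" for g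
    using mult[of "inv\<^bsub>Diff1 S2\<^esub> g" g] one that by simp
  have \<sigma>_in: "\<sigma> g \<in> {-1, 1} \<times> {-1, 1}" if "g \<in> G" for g
    using det_radial_D_diffeo(3)[OF diffeo[OF that]] inv[OF that] by (auto simp: \<sigma>_def zmult_eq_1_iff)
  have K: "subgroup K (Diff1 S2)"
  proof (rule D.subgroupI)
    show "K \<subseteq> carrier (Diff1 S2)" by (auto simp: K_def)
    show "K \<noteq> {}" using one S.one_closed unfolding K_def by blast
    show "inv\<^bsub>Diff1 S2\<^esub> g \<in> K" if "g \<in> K" for g
      using that inv[of g] by (auto simp: K_def prod_eq_iff)
    show "f \<otimes>\<^bsub>Diff1 S2\<^esub> g \<in> K" if "f \<in> K" "g \<in> K" for f g
      using that mult[of f g] by (auto simp: K_def)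
  qed
  have finK: "finite K"
    by (rule finite_orientation_preserving_2_group[OF K]) (use exponent in \<open>auto simp: K_def \<sigma>_def\<close>)
  show ?thesis
  proof (rule finite_if_finite_fibers[of "{-1, 1} \<times> {-1, 1}" \<sigma>])
    show "\<sigma> ` G \<subseteq> {-1, 1} \<times> {-1, 1}" using \<sigma>_in by blast
    fix y
    show "finite {g \<in> G. \<sigma> g = y}"
    proof (cases "\<exists>h\<in>G. \<sigma> h = y")
      case True
      then obtain h where h: "h \<in> G" "\<sigma> h = y" by blast
      have "{g \<in> G. \<sigma> g = y} \<subseteq> (\<lambda>s. h \<otimes>\<^bsub>Diff1 S2\<^esub> s) ` K"
      proof
        fix g assume "g \<in> {g \<in> G. \<sigma> g = y}"
        then have g: "g \<in> G" "\<sigma> g = \<sigma> h" using h by auto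
        have "inv\<^bsub>Diff1 S2\<^esub> h \<otimes>\<^bsub>Diff1 S2\<^esub> g \<in> K"
          using mult[of "inv\<^bsub>Diff1 S2\<^esub> h" g] inv[OF h(1)] g h by (simp add: K_def)
        moreover have "g = h \<otimes>\<^bsub>Diff1 S2\<^esub> (inv\<^bsub>Diff1 S2\<^esub> h \<otimes>\<^bsub>Diff1 S2\<^esub> g)"
          using g h by (simp flip: D.m_assoc)
        ultimately show "g \<in> (\<lambda>s. h \<otimes>\<^bsub>Diff1 S2\<^esub> s) ` K" by blast
      qed
      then show ?thesis using finK by (meson finite_imageI finite_subset)
    qed (auto intro: finite_subset[of _ "{}"])
  qed simp
qed

end
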